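(* Let $\{\lambda,\underline m\}$ be a pointed knapsack partition of $n$ with $m>0$, where $\lambda$ has $k$ parts. The homology groups $\widetilde H_{k-1}(\Delta(\Pi^\bullet_{\{\lambda,\underline m\}}-\{\hat 1\}))$ and $\widetilde H_{k-1}(\Lambda_{\{\lambda,\underline m\}})$ are isomorphic as $\mathfrak S_n$-modules.
   Context: An integer partition $\lambda=\{\lambda_1^{e_1},\dots,\lambda_q^{e_q}\}$ ($\lambda_i$ distinct positive integers with multiplicities $e_i$) is a knapsack partition if the sums $\sum_i f_i\lambda_i$, $0\le f_i\le e_i$, are pairwise distinct. A pointed knapsack partition $\{\lambda,\underline m\}$ of $n$ is a knapsack partition $\lambda$ with an integer $m\ge0$ such that the total is $n$. A pointed set partition of $[n]$ is $\{B_1,\dots,B_j,\underline Z\}$ with $Z\subseteq[n]$ possibly empty (pointed block) and nonempty blocks $B_i$ partitioning $[n]\setminus Z$; its type is the multiset $\{|B_i|\}$ with pointed number $|Z|$. $\Pi^\bullet_n$ is ordered by $\pi\le\pi'$ iff each non-pointed block of $\pi$ lies in a block of $\pi'$ and the pointed block of $\pi$ lies in that of $\pi'$. $\Pi^\bullet_{\{\lambda,\underline m\}}$ is the filter of $\Pi^\bullet_n$ generated by the pointed set partitions of type $\{\lambda,\underline m\}$, with maximum $\hat 1=\{\underline{[n]}\}$; $\Delta(P)$ is the order complex. An ordered set partition of $[n]$ is $(C_1,\dots,C_r)$, disjoint with union $[n]$, $C_1,\dots,C_{r-1}$ nonempty, $C_r$ possibly empty; $\Delta_n$ is the simplicial complex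 with these faces ($(C_1,\dots,C_r)$ of dimension $r-2$, faces by merging consecutive blocks, $([n])$ the empty face), and $\Lambda_{\{\lambda,\underline m\}}$ is its subcomplex of $(C_1,\dots,C_r)$ with $\{C_1,\dots,C_{r-1},\underline{C_r}\}\in\Pi^\bullet_{\{\lambda,\underline m\}}$. $\mathfrak S_n$ acts by relabeling; homology is reduced with coefficients in a fixed field. *)

theory Defs
  imports
    Complex_Main
    "HOL-Library.Multiset"
    "HOL-Library.Disjoint_Sets"
    "HOL-Combinatorics.Permutations"
begin

section \<open>Pointed knapsack partitions\<close>

text \<open>
  An integer partition is a finite multiset of positive integers. The choices
  0 \<le> f_i \<le> e_i are exactly the submultisets of the partition.
\<close>

definition knapsack_partition :: "nat multiset \<Rightarrow> bool" where
  "knapsack_partition lam \<longleftrightarrow> 0 \<notin># lam \<and> inj_on sum_mset {mu. mu \<subseteq># lam}"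

definition pointed_knapsack_partition :: "nat multiset \<Rightarrow> nat \<Rightarrow> nat \<Rightarrow> bool" where
  "pointed_knapsack_partition lam m n \<longleftrightarrow> knapsack_partition lam \<and> sum_mset lam + m = n"


section \<open>Pointed set partitions\<close>

text \<open>The pair \<open>(P, Z)\<close> has set of non-pointed blocks \<open>P\<close> and pointed block \<open>Z\<close>.\<close>

type_synonym pointed_part = "nat set set \<times> nat set"

definition pointed_partitions :: "nat \<Rightarrow> pointed_part set" where
  "pointed_partitions n = {(P, Z). Z \<subseteq> {1..n} \<and> partition_on ({1..n} - Z) P}"

fun pointed_le :: "pointed_part \<Rightarrow> pointed_part \<Rightarrow> bool" where
  "pointed_le (P, Z) (P', Z') \<longleftrightarrow> (\<forall>B\<in>P. \<exists>B'\<in>insert Z' P'. B \<subseteq> B') \<and> Z \<subseteq> Z'"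

fun pointed_type :: "pointed_part \<Rightarrow> nat multiset \<times> nat" where
  "pointed_type (P, Z) = (image_mset card (mset_set P), card Z)"

definition pointed_filter :: "nat \<Rightarrow> nat multiset \<Rightarrow> nat \<Rightarrow> pointed_part set" where
  "pointed_filter n lam m =
     {p \<in> pointed_partitions n.
        \<exists>q \<in> pointed_partitions n. pointed_type q = (lam, m) \<and> pointed_le q p}"

definition pointed_top :: "nat \<Rightarrow> pointed_part" where
  "pointed_top n = ({}, {1..n})"

fun relabel_pointed :: "(nat \<Rightarrow> nat) \<Rightarrow> pointed_part \<Rightarrow> pointed_part" where
  "relabel_pointed s (P, Z) = (image s ` P, s ` Z)"


section \<open>Simplicial complexes\<close>

text \<open>
  A simplicial complex is given by its set of faces, each face being the finite set
  of its vertices; the empty face is included.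
\<close>

definition order_complex :: "('a \<Rightarrow> 'a \<Rightarrow> bool) \<Rightarrow> 'a set \<Rightarrow> 'a set set" where
  "order_complex le P = {C. finite C \<and> C \<subseteq> P \<and> Complete_Partial_Order.chain le C}"

definition ordered_set_partitions :: "nat \<Rightarrow> nat set list set" where
  "ordered_set_partitions n =
     {Cs. Cs \<noteq> [] \<and> (\<forall>C \<in> set (butlast Cs). C \<noteq> {}) \<and>
          (\<forall>i < length Cs. \<forall>j < length Cs. i \<noteq> j \<longrightarrow> Cs ! i \<inter> Cs ! j = {}) \<and>
          \<Union> (set Cs) = {1..n}}"

text \<open>\<open>Ds\<close> arises from \<open>Cs\<close> by merging (nonempty) runs of consecutive blocks.\<close>

definition merges_to :: "nat set list \<Rightarrow> nat set list \<Rightarrow> bool" where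
  "merges_to Cs Ds \<longleftrightarrow>
     (\<exists>Css. [] \<notin> set Css \<and> concat Css = Cs \<and> Ds = map (\<lambda>Bs. \<Union> (set Bs)) Css)"

text \<open>
  \<open>(C\<^sub>1, \<dots>, C\<^sub>r)\<close> has dimension \<open>r - 2\<close>, so the vertices of the complex are the ordered set
  partitions with two blocks, and a face is recorded by its set of vertices, i.e.\ by
  the two-block ordered set partitions obtained from it by merging. See
  \<open>osp_simplex_cuts\<close>, \<open>card_osp_simplex\<close> and \<open>osp_simplex_subset_iff\<close> below.
\<close>

definition osp_simplex :: "nat set list \<Rightarrow> nat set list set" where
  "osp_simplex Cs = {V. merges_to Cs V \<and> length V = 2}"

definition Delta_complex :: "nat \<Rightarrow> nat set list set set" where
  "Delta_complex n = osp_simplex ` ordered_set_partitions n"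

fun forget_order :: "nat set list \<Rightarrow> pointed_part" where
  "forget_order Cs = (set (butlast Cs), last Cs)"

definition Lambda_complex :: "nat \<Rightarrow> nat multiset \<Rightarrow> nat \<Rightarrow> nat set list set set" where
  "Lambda_complex n lam m =
     osp_simplex ` {Cs \<in> ordered_set_partitions n. forget_order Cs \<in> pointed_filter n lam m}"

definition relabel_osp :: "(nat \<Rightarrow> nat) \<Rightarrow> nat set list \<Rightarrow> nat set list" where
  "relabel_osp s Cs = map (image s) Cs"


section \<open>Reduced simplicial homology with a group action\<close>

text \<open>
  Oriented chains: a \<open>d\<close>-chain is a finitely supported function on the orderings of the
  \<open>d\<close>-dimensional faces that changes sign under odd reorderings. The oriented simplex
  \<open>[v\<^sub>0, \<dots>, v\<^sub>d]\<close> is the chain with value \<open>sign p\<close> on the reordering of \<open>v\<^sub>0, \<dots>, v\<^sub>d\<close> by \<open>p\<close>, and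
  0 elsewhere. No ordering of the vertices has to be chosen, and \<open>d = -1\<close> (the empty
  list) gives the augmentation term.
\<close>

definition simplicial_chains :: "'v set set \<Rightarrow> int \<Rightarrow> ('v list \<Rightarrow> 'f::field) set" where
  "simplicial_chains K d =
     {c. finite {xs. c xs \<noteq> 0} \<and>
         (\<forall>xs. c xs \<noteq> 0 \<longrightarrow> distinct xs \<and> set xs \<in> K \<and> int (length xs) = d + 1) \<and>
         (\<forall>xs p. p permutes {..<length xs} \<longrightarrow> c (permute_list p xs) = of_int (sign p) * c xs)}"

text \<open>
  This is the linear map sending \<open>[v\<^sub>0, \<dots>, v\<^sub>d]\<close> to the alternating sum over \<open>i\<close> of
  \<open>(-1)^i [v\<^sub>0, \<dots>, v\<^sub>d]\<close> with \<open>v\<^sub>i\<close> omitted: \<open>[v\<^sub>i, v\<^sub>0, \<dots>]\<close> (\<open>v\<^sub>i\<close> moved to the front)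
  equals \<open>(-1)^i [v\<^sub>0, \<dots>, v\<^sub>d]\<close>.
\<close>

definition simplicial_boundary :: "('v list \<Rightarrow> 'f::field) \<Rightarrow> 'v list \<Rightarrow> 'f" where
  "simplicial_boundary c = (\<lambda>ys. \<Sum>v | c (v # ys) \<noteq> 0. c (v # ys))"

definition simplicial_cycles :: "'v set set \<Rightarrow> int \<Rightarrow> ('v list \<Rightarrow> 'f::field) set" where
  "simplicial_cycles K d = {c \<in> simplicial_chains K d. simplicial_boundary c = (\<lambda>_. 0)}"

definition simplicial_boundaries :: "'v set set \<Rightarrow> int \<Rightarrow> ('v list \<Rightarrow> 'f::field) set" where
  "simplicial_boundaries K d = simplicial_boundary ` simplicial_chains K (d + 1)"

record ('f, 'g, 'm) gmodule =
  gcarrier :: "'m set"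
  gadd :: "'m \<Rightarrow> 'm \<Rightarrow> 'm"
  gscale :: "'f \<Rightarrow> 'm \<Rightarrow> 'm"
  gact :: "'g \<Rightarrow> 'm \<Rightarrow> 'm"

text \<open>
  The homology is the quotient of cycles by boundaries: its elements are cosets, with
  the operations induced from the pointwise ones on chains. In \<open>gscale\<close> the boundaries are
  added so that \<open>r = 0\<close> also yields a full coset. The parameter \<open>a\<close> is an action on vertices.
\<close>

definition reduced_homology ::
  "(('x \<Rightarrow> 'x) \<Rightarrow> 'v \<Rightarrow> 'v) \<Rightarrow> 'v set set \<Rightarrow> int \<Rightarrow>
    ('f::field, 'x \<Rightarrow> 'x, ('v list \<Rightarrow> 'f) set) gmodule" where
  "reduced_homology a K d =
     \<lparr> gcarrier = (\<lambda>z. {\<lambda>xs. z xs + b xs | b. b \<in> simplicial_boundaries K d}) ` simplicial_cycles K d,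
       gadd = (\<lambda>A B. {\<lambda>xs. x xs + y xs | x y. x \<in> A \<and> y \<in> B}),
       gscale = (\<lambda>r A. {\<lambda>xs. r * x xs + b xs | x b. x \<in> A \<and> b \<in> simplicial_boundaries K d}),
       gact = (\<lambda>s A. (\<lambda>c xs. c (map (a (inv s)) xs)) ` A) \<rparr>"

definition gmodule_isomorphic ::
  "'g set \<Rightarrow> ('f, 'g, 'm) gmodule \<Rightarrow> ('f, 'g, 'k) gmodule \<Rightarrow> bool" where
  "gmodule_isomorphic G M N \<longleftrightarrow>
     (\<exists>\<phi>. bij_betw \<phi> (gcarrier M) (gcarrier N) \<and>
        (\<forall>x \<in> gcarrier M. \<forall>y \<in> gcarrier M. \<phi> (gadd M x y) = gadd N (\<phi> x) (\<phi> y)) \<and>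
        (\<forall>r. \<forall>x \<in> gcarrier M. \<phi> (gscale M r x) = gscale N r (\<phi> x)) \<and>
        (\<forall>g \<in> G. \<forall>x \<in> gcarrier M. \<phi> (gact M g x) = gact N g (\<phi> x)))"


section \<open>Ordered set partitions as simplices\<close>

abbreviation cut :: "nat set list \<Rightarrow> nat \<Rightarrow> nat set list" where
  "cut Cs i \<equiv> [\<Union> (set (take i Cs)), \<Union> (set (drop i Cs))]"

lemma osp_simplex_cuts: "osp_simplex Cs = cut Cs ` {1..<length Cs}"
proof (intro equalityI subsetI)
  fix V assume "V \<in> osp_simplex Cs"
  then obtain Css where c: "[] \<notin> set Css" "concat Css = Cs" "V = map (\<lambda>Bs. \<Union> (set Bs)) Css"
    "length Css = 2" by (auto simp: osp_simplex_def merges_to_def)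
  then obtain X Y where "Css = [X, Y]"
    by (metis One_nat_def Suc_1 length_0_conv length_Suc_conv)
  with c have "V = cut Cs (length X)" "length X \<in> {1..<length Cs}" "X \<noteq> []"
    by (auto simp: Suc_le_eq)
  then show "V \<in> cut Cs ` {1..<length Cs}" by blast
next
  fix V assume "V \<in> cut Cs ` {1..<length Cs}"
  then obtain i where i: "1 \<le> i" "i < length Cs" "V = cut Cs i" by auto
  then have "merges_to Cs V" unfolding merges_to_def
    by (intro exI[of _ "[take i Cs, drop i Cs]"]) auto
  with i show "V \<in> osp_simplex Cs" by (simp add: osp_simplex_def)
qed

lemma osp_take_inject:
  fixes Cs :: "nat set list"
  assumes "\<forall>C \<in> set (butlast Cs). C \<noteq> {}"
    and "\<forall>i < length Cs. \<forall>j < length Cs. i \<noteq> j \<longrightarrow> Cs ! i \<inter> Cs ! j = {}"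
    and "i < j" "j < length Cs"
  shows "\<not> \<Union> (set (take j Cs)) \<subseteq> \<Union> (set (take i Cs))"
proof
  assume sub: "\<Union> (set (take j Cs)) \<subseteq> \<Union> (set (take i Cs))"
  have "Cs ! i \<in> set (butlast Cs)"
    using assms(3,4) nth_butlast[of i Cs] nth_mem[of i "butlast Cs"] by simp
  then obtain x where x: "x \<in> Cs ! i" using assms(1) by blast
  have "Cs ! i \<in> set (take j Cs)" using assms(3,4) by (auto simp: in_set_conv_nth)
  with x sub have "x \<in> \<Union> (set (take i Cs))" by blast
  then obtain E where "E \<in> set (take i Cs)" "x \<in> E" by blast
  moreover from this(1) obtain l where "l < i" "E = Cs ! l" by (auto simp: in_set_conv_nth)
  ultimately have "l < i" "x \<in> Cs ! l" by auto
  then show False using assms(2)[rule_format, of l i] assms(3,4) x by auto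
qed

lemma card_osp_simplex:
  assumes "Cs \<in> ordered_set_partitions n"
  shows "card (osp_simplex Cs) = length Cs - 1"
proof -
  have "inj_on (cut Cs) {1..<length Cs}"
  proof (rule linorder_inj_onI')
    fix i j assume "i \<in> {1..<length Cs}" "j \<in> {1..<length Cs}" "i < j"
    then show "cut Cs i \<noteq> cut Cs j"
      using osp_take_inject[of Cs i j] assms by (auto simp: ordered_set_partitions_def)
  qed
  then show ?thesis by (simp add: osp_simplex_cuts card_image)
qed

lemma merges_to_imp_subset:
  assumes "merges_to Cs Ds"
  shows "osp_simplex Ds \<subseteq> osp_simplex Cs"
proof
  fix V assume "V \<in> osp_simplex Ds"
  then obtain i where i: "1 \<le> i" "i < length Ds" "V = cut Ds i"
    by (auto simp: osp_simplex_cuts)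
  from assms obtain Css where c: "[] \<notin> set Css" "concat Css = Cs"
    "Ds = map (\<lambda>Bs. \<Union> (set Bs)) Css" by (auto simp: merges_to_def)
  let ?X = "concat (take i Css)" and ?Y = "concat (drop i Css)"
  have Cs: "Cs = ?X @ ?Y" using c(2) by (metis append_take_drop_id concat_append)
  have "Css ! 0 \<in> set (take i Css)" "Css ! i \<in> set (drop i Css)"
    using i c(3) by (auto simp: in_set_conv_nth intro: exI[of _ 0])
  moreover from this have "Css ! 0 \<noteq> []" "Css ! i \<noteq> []"
    using c(1) in_set_takeD in_set_dropD by metis+
  ultimately have "?X \<noteq> []" "?Y \<noteq> []" unfolding concat_eq_Nil_conv by blast+
  moreover have "V = [\<Union> (set ?X), \<Union> (set ?Y)]"
    using i c(3) by (auto simp: take_map drop_map)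
  ultimately have "merges_to Cs V" unfolding merges_to_def
    using Cs by (intro exI[of _ "[?X, ?Y]"]) auto
  then show "V \<in> osp_simplex Cs" using i by (simp add: osp_simplex_def)
qed

lemma subset_imp_merges_to:
  fixes Cs Ds :: "nat set list"
  assumes "Cs \<noteq> []" "Ds \<noteq> []" "\<Union> (set Cs) = \<Union> (set Ds)"
    and "\<forall>i < length Cs. \<forall>j < length Cs. i \<noteq> j \<longrightarrow> Cs ! i \<inter> Cs ! j = {}"
    and "\<forall>D \<in> set (butlast Ds). D \<noteq> {}"
    and "\<forall>i < length Ds. \<forall>j < length Ds. i \<noteq> j \<longrightarrow> Ds ! i \<inter> Ds ! j = {}"
    and "osp_simplex Ds \<subseteq> osp_simplex Cs"
  shows "merges_to Cs Ds"
  using assms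
proof (induction Ds arbitrary: Cs)
  case Nil
  then show ?case by simp
next
  case (Cons D Ds)
  show ?case
  proof (cases "Ds = []")
    case True
    then show ?thesis using Cons.prems unfolding merges_to_def
      by (intro exI[of _ "[Cs]"]) auto
  next
    case False
    have cutin: "cut (D # Ds) i \<in> cut Cs ` {1..<length Cs}" if "1 \<le> i" "i < length (D # Ds)" for i
      using Cons.prems(7) that unfolding osp_simplex_cuts by auto
    from cutin[of 1] False obtain k where k: "1 \<le> k" "k < length Cs"
      "D = \<Union> (set (take k Cs))" "\<Union> (set Ds) = \<Union> (set (drop k Cs))" by auto
    have Ddisj: "D \<inter> E = {}" if "E \<in> set Ds" for E
    proof -
      from that obtain l where "l < length Ds" "E = Ds ! l" by (auto simp: in_set_conv_nth)
      then show ?thesis using Cons.prems(6)[rule_format, of 0 "Suc l"] by simp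
    qed
    have "merges_to (drop k Cs) Ds"
    proof (rule Cons.IH)
      show "drop k Cs \<noteq> []" "Ds \<noteq> []" "\<Union> (set (drop k Cs)) = \<Union> (set Ds)"
        using k False by auto
      show "\<forall>i < length (drop k Cs). \<forall>j < length (drop k Cs). i \<noteq> j \<longrightarrow> drop k Cs ! i \<inter> drop k Cs ! j = {}"
        using Cons.prems(4) k by simp
      show "\<forall>D \<in> set (butlast Ds). D \<noteq> {}" using Cons.prems(5) False by simp
      show "\<forall>i < length Ds. \<forall>j < length Ds. i \<noteq> j \<longrightarrow> Ds ! i \<inter> Ds ! j = {}"
        using Cons.prems(6) by fastforce
      show "osp_simplex Ds \<subseteq> osp_simplex (drop k Cs)"
      proof
        fix V assume "V \<in> osp_simplex Ds"
        then obtain i where i: "1 \<le> i" "i < length Ds" "V = cut Ds i"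
          by (auto simp: osp_simplex_cuts)
        from cutin[of "Suc i"] i obtain j where j: "1 \<le> j" "j < length Cs"
          "D \<union> \<Union> (set (take i Ds)) = \<Union> (set (take j Cs))"
          "\<Union> (set (drop i Ds)) = \<Union> (set (drop j Cs))" by auto
        have T: "D \<inter> \<Union> (set (take i Ds)) = {}" using Ddisj by (auto dest: in_set_takeD)
        have "hd Ds \<in> set (butlast Ds)" using i by (cases Ds) auto
        then have "hd Ds \<noteq> {}" using Cons.prems(5) False by auto
        moreover have "hd Ds \<in> set (take i Ds)" using i by (cases Ds; cases i) auto
        ultimately have "\<not> \<Union> (set (take i Ds)) \<subseteq> {}" by auto
        then have "\<not> \<Union> (set (take j Cs)) \<subseteq> D" using T j(3) by blast
        then have "k < j" using k(3)
          using set_take_subset_set_take[of j k Cs] by (meson Union_mono linorder_not_less order_trans order_refl)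
        then have "take j Cs = take k Cs @ take (j - k) (drop k Cs)"
          using take_add[of k "j - k" Cs] by simp
        then have U: "D \<union> \<Union> (set (take i Ds)) = D \<union> \<Union> (set (take (j - k) (drop k Cs)))"
          using j(3) k(3) by simp
        have "D \<inter> \<Union> (set (drop k Cs)) = {}"
          using Ddisj k(4) by blast
        then have "D \<inter> \<Union> (set (take (j - k) (drop k Cs))) = {}" by (auto dest: in_set_takeD)
        with U T have "\<Union> (set (take i Ds)) = \<Union> (set (take (j - k) (drop k Cs)))" by blast
        then have "V = cut (drop k Cs) (j - k)" using i j \<open>k < j\<close> by simp
        moreover have "j - k \<in> {1..<length (drop k Cs)}"
          using j(2) \<open>k < j\<close> by (simp add: Suc_le_eq diff_less_mono)
        ultimately show "V \<in> osp_simplex (drop k Cs)" unfolding osp_simplex_cuts by blast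
      qed
    qed
    then obtain Css where "[] \<notin> set Css" "concat Css = drop k Cs"
      "Ds = map (\<lambda>Bs. \<Union> (set Bs)) Css" by (auto simp: merges_to_def)
    then show ?thesis unfolding merges_to_def
      using k by (intro exI[of _ "take k Cs # Css"]) auto
  qed
qed

lemma osp_simplex_subset_iff:
  assumes "Cs \<in> ordered_set_partitions n" "Ds \<in> ordered_set_partitions n"
  shows "osp_simplex Ds \<subseteq> osp_simplex Cs \<longleftrightarrow> merges_to Cs Ds"
proof
  assume "osp_simplex Ds \<subseteq> osp_simplex Cs"
  moreover from assms have "Cs \<noteq> []" "Ds \<noteq> []" "\<Union> (set Cs) = \<Union> (set Ds)"
    "\<forall>i < length Cs. \<forall>j < length Cs. i \<noteq> j \<longrightarrow> Cs ! i \<inter> Cs ! j = {}"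
    "\<forall>D \<in> set (butlast Ds). D \<noteq> {}"
    "\<forall>i < length Ds. \<forall>j < length Ds. i \<noteq> j \<longrightarrow> Ds ! i \<inter> Ds ! j = {}"
    by (simp_all add: ordered_set_partitions_def)
  ultimately show "merges_to Cs Ds" by (intro subset_imp_merges_to)
qed (rule merges_to_imp_subset)

end

theory Submission
  imports Defs
begin

text \<open>
  An ordered set partition \<open>(C\<^sub>1, \<dots>, C\<^sub>r)\<close> is the chain of its partial unions, and it lies above a
  pointed set partition \<open>p\<close> iff these unions are saturated for \<open>p\<close>: disjoint from the pointed block
  and a union of other blocks. So, as in Quillen's fibre lemma, the ordered set partitions above
  a fixed \<open>p \<noteq> top\<close> form a cone, whose apex is the union of all non-pointed blocks.

  Let \<open>M\<close> be the complex on the disjoint union of the vertices of \<open>\<Delta>(\<Pi> - {top})\<close> and \<open>\<Lambda>\<close> with faces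
  \<open>c \<union> \<sigma>\<close>, for a chain \<open>c\<close> and a face \<open>\<sigma>\<close> above every element of \<open>c\<close>. Deleting from \<open>M\<close> the stars of
  the poset elements, maximal ones first, leaves \<open>\<Lambda>\<close>; deleting the stars of the nonempty faces of \<open>\<Lambda>\<close>,
  maximal ones first, leaves \<open>\<Delta>(\<Pi> - {top})\<close>. Each time the link is a cone, so both inclusions into
  \<open>M\<close> are isomorphisms on homology. Nothing was chosen in forming \<open>M\<close>, hence the resulting
  isomorphism is equivariant.
\<close>

section \<open>Alternating chains\<close>

text \<open>The obstacle is equivariance: the deletions follow an order of removal that the group
  need not respect. They therefore serve only to show that relative homology vanishes. Maximality is
  what turns the links into cones. If p is maximal among the remaining poset elements, every other
  element of a chain through p lies below p, and a set saturated for p is saturated for all of them,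
  so one apex serves the whole chain. If \<sigma> is maximal among the remaining faces, the poset
  elements that can accompany it are those below the pointed partition underlying \<sigma>, and that
  partition is the apex. The top has no non-pointed blocks, so its would-be apex is the empty set,
  which is not a vertex. It is the counterpart of the empty face, which is never deleted.\<close>

definition alternating :: "('v list \<Rightarrow> 'f::field) \<Rightarrow> bool" where
  "alternating c \<longleftrightarrow> (\<forall>us x y vs. c (us @ x # y # vs) = - c (us @ y # x # vs))"

lemma alternatingD: "alternating c \<Longrightarrow> c (us @ x # y # vs) = - c (us @ y # x # vs)"
  unfolding alternating_def by blast

lemma alternatingI:
  "(\<And>us x y vs. c (us @ x # y # vs) = - c (us @ y # x # vs)) \<Longrightarrow> alternating c"
  unfolding alternating_def by blast

lemma alternating_Cons: "alternating c \<Longrightarrow> alternating (\<lambda>ws. c (z # ws))"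
  unfolding alternating_def by (metis append_Cons)

lemma alternating_restrict:
  fixes c :: "'v list \<Rightarrow> 'f::field"
  assumes "alternating c"
  shows "alternating (\<lambda>xs. if Q (set xs) then c xs else 0)"
  unfolding alternating_def
proof (intro allI)
  fix us :: "'v list" and x y vs
  have "set (us @ x # y # vs) = set (us @ y # x # vs)" by auto
  then show "(if Q (set (us @ x # y # vs)) then c (us @ x # y # vs) else 0) =
      - (if Q (set (us @ y # x # vs)) then c (us @ y # x # vs) else 0)"
    using alternatingD[OF assms, of us x y vs] by simp
qed

lemma alternating_move:
  assumes "alternating c"
  shows "c (us @ x # ms @ vs) = (-1) ^ length ms * c (us @ ms @ x # vs)"
proof (induction ms arbitrary: us)
  case (Cons m ms)
  have "c (us @ x # (m # ms) @ vs) = - c ((us @ [m]) @ x # ms @ vs)"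
    using alternatingD[OF assms, of us x m "ms @ vs"] by simp
  also have "\<dots> = (-1) ^ length (m # ms) * c (us @ (m # ms) @ x # vs)"
    unfolding Cons.IH by simp
  finally show ?case .
qed simp

text \<open>Carrying \<open>x\<close> right across \<open>ms\<close> and carrying \<open>y\<close>
  back left across \<open>ms\<close> cost the same sign; these cancel, and the exchange of the two
  neighbours in between leaves one minus.\<close>

lemma alternating_swap:
  assumes "alternating c"
  shows "c (us @ x # ms @ y # vs) = - c (us @ y # ms @ x # vs)"
proof -
  have "c (us @ x # ms @ y # vs) = (-1) ^ length ms * c ((us @ ms) @ x # y # vs)"
    using alternating_move[OF assms, of us x ms "y # vs"] by simp
  also have "\<dots> = - ((-1) ^ length ms * c (us @ ms @ y # x # vs))"
    using alternatingD[OF assms, of "us @ ms" x y vs] by simp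
  also have "\<dots> = - c (us @ y # ms @ x # vs)"
    using alternating_move[OF assms, of us y ms "x # vs"] by simp
  finally show ?thesis .
qed

lemma permute_list_transpose_split:
  "permute_list (Transposition.transpose (length us) (Suc (length us + length ms)))
     (us @ x # ms @ y # vs) = us @ y # ms @ x # vs" (is "permute_list ?t ?xs = ?ys")
proof (rule nth_equalityI)
  show "length (permute_list ?t ?xs) = length ?ys" by simp
next
  fix i assume i: "i < length (permute_list ?t ?xs)"
  have "permute_list ?t ?xs ! i = ?xs ! ?t i"
    using i by (intro permute_list_nth permutes_swap_id) auto
  then show "permute_list ?t ?xs ! i = ?ys ! i"
    by (auto simp: Transposition.transpose_def nth_append nth_Cons split: nat.splits)
qed

lemma alternating_transpose:
  assumes "alternating c" "i < length xs" "j < length xs" "i < j"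
  shows "c (permute_list (Transposition.transpose i j) xs) = - c xs"
proof -
  define us ms vs where "us = take i xs" and "ms = take (j - Suc i) (drop (Suc i) xs)"
    and "vs = drop (Suc j) xs"
  have *: "xs = us @ xs ! i # ms @ xs ! j # vs"
  proof -
    have "xs = us @ xs ! i # drop (Suc i) xs"
      using assms by (simp add: us_def id_take_nth_drop[symmetric])
    moreover have "drop (Suc i) xs = ms @ xs ! j # vs"
      using id_take_nth_drop[of "j - Suc i" "drop (Suc i) xs"] assms by (simp add: ms_def vs_def)
    ultimately show ?thesis by simp
  qed
  have len: "length us = i" "Suc (length us + length ms) = j"
    using assms by (auto simp: us_def ms_def)
  have "permute_list (Transposition.transpose i j) (us @ xs ! i # ms @ xs ! j # vs)
      = us @ xs ! j # ms @ xs ! i # vs"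
    using permute_list_transpose_split[of us ms "xs ! i" "xs ! j" vs] len by simp
  then show ?thesis using alternating_swap[OF assms(1), of us "xs ! i" ms "xs ! j" vs] *
    by simp
qed

text \<open>Permutations are products of transpositions, and each transposition negates both sides.
  The induction composes the new transposition on the right, so that
  \<open>permute_list_compose\<close> applies it last, to the list already permuted by
  \<open>p\<close>.\<close>

lemma alternating_permute_list:
  assumes "alternating c" "p permutes {..<length xs}"
  shows "c (permute_list p xs) = of_int (sign p) * c xs"
  using finite_lessThan[of "length xs"] assms(2)
proof (induction arbitrary: rule: permutes_rev_induct)
  case id
  then show ?case by simp
next
  case (swap a b p)
  let ?t = "Transposition.transpose a b"
  have t: "?t permutes {..<length xs}" using swap by (intro permutes_swap_id) auto
  have "permutation p" "permutation ?t"
    using swap t finite_lessThan permutation_permutes by blast+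
  then have "sign (p \<circ> ?t) = sign p * sign ?t" by (rule sign_compose)
  then have s: "sign (p \<circ> ?t) = - sign p" using swap by (simp add: sign_swap_id)
  have "permute_list (p \<circ> ?t) xs = permute_list ?t (permute_list p xs)"
    using t by (rule permute_list_compose)
  moreover have "c (permute_list ?t (permute_list p xs)) = - c (permute_list p xs)"
  proof (cases "a < b")
    case True
    then show ?thesis using swap by (intro alternating_transpose[OF assms(1)]) auto
  next
    case False
    then have "b < a" using swap by auto
    then show ?thesis using swap
      by (subst transpose_commute) (intro alternating_transpose[OF assms(1)], auto)
  qed
  ultimately show ?case using swap s by (simp add: comp_def)
qed

lemma alternating_if_permute_list:
  fixes c :: "'v list \<Rightarrow> 'f::field"
  assumes "\<And>xs p. p permutes {..<length xs} \<Longrightarrow> c (permute_list p xs) = of_int (sign p) * c xs"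
  shows "alternating c"
  unfolding alternating_def
proof (intro allI)
  fix us vs :: "'v list" and x y
  let ?t = "Transposition.transpose (length us) (Suc (length us))"
  have "permute_list ?t (us @ x # y # vs) = us @ y # x # vs"
    using permute_list_transpose_split[of us "[]" x y vs] by simp
  moreover have "?t permutes {..<length (us @ x # y # vs)}"
    by (intro permutes_swap_id) auto
  from assms[OF this] have "c (permute_list ?t (us @ x # y # vs)) = - c (us @ x # y # vs)"
    by (simp add: sign_swap_id)
  ultimately show "c (us @ x # y # vs) = - c (us @ y # x # vs)" by simp
qed

lemma finite_chain_support:
  assumes "finite (\<Union>K)" "\<And>xs. c xs \<noteq> 0 \<Longrightarrow> distinct xs \<and> set xs \<in> K"
  shows "finite {xs. c xs \<noteq> 0}"
proof (rule finite_subset)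
  show "{xs. c xs \<noteq> 0} \<subseteq> {xs. distinct xs \<and> set xs \<subseteq> \<Union>K}" using assms(2) by blast
  show "finite {xs. distinct xs \<and> set xs \<subseteq> \<Union>K}"
    using finite_subset_distinct[OF assms(1)] by (simp add: conj_commute)
qed

text \<open>Over finitely many vertices finite support is automatic, and the sign rule only has to
  be checked on neighbours. Distinctness stays a separate condition: in characteristic 2 no sign
  rule forces the value 0 on a list with a repetition.\<close>

lemma simplicial_chains_iff:
  assumes "finite (\<Union>K)"
  shows "c \<in> simplicial_chains K d \<longleftrightarrow>
    (\<forall>xs. c xs \<noteq> 0 \<longrightarrow> distinct xs \<and> set xs \<in> K \<and> int (length xs) = d + 1) \<and> alternating c"
    (is "_ \<longleftrightarrow> ?R")
proof
  assume "c \<in> simplicial_chains K d"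
  then show ?R unfolding simplicial_chains_def
    by (auto intro!: alternating_if_permute_list)
next
  assume R: ?R
  then have "finite {xs. c xs \<noteq> 0}" using finite_chain_support[OF assms, of c] by blast
  with R show "c \<in> simplicial_chains K d" unfolding simplicial_chains_def
    by (auto intro: alternating_permute_list)
qed

section \<open>Chain spaces: supports and linear operations\<close>

lemma chain_support:
  assumes "c \<in> simplicial_chains K d" "c xs \<noteq> 0"
  shows "distinct xs" "set xs \<in> K" "int (length xs) = d + 1"
  using assms unfolding simplicial_chains_def by auto

lemma chain_finite_vertices:
  assumes "c \<in> simplicial_chains K d"
  obtains U where "finite U" "\<And>xs. c xs \<noteq> 0 \<Longrightarrow> set xs \<subseteq> U"
proof
  show "finite (\<Union> (set ` {xs. c xs \<noteq> 0}))"
    using assms unfolding simplicial_chains_def by auto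
qed auto

lemma chain_alternating: "c \<in> simplicial_chains K d \<Longrightarrow> alternating c"
  unfolding simplicial_chains_def by (auto intro!: alternating_if_permute_list)

lemma chains_mono: "K \<subseteq> M \<Longrightarrow> simplicial_chains K d \<subseteq> simplicial_chains M d"
  unfolding simplicial_chains_def by blast

lemma chains_zero: "(\<lambda>_. 0) \<in> simplicial_chains K d"
  unfolding simplicial_chains_def by auto

lemma chains_scale: "x \<in> simplicial_chains K d \<Longrightarrow> (\<lambda>xs. r * x xs) \<in> simplicial_chains K d"
  unfolding simplicial_chains_def by (auto intro: rev_finite_subset)

lemma chains_add:
  assumes "x \<in> simplicial_chains K d" "y \<in> simplicial_chains K d"
  shows "(\<lambda>xs. x xs + y xs) \<in> simplicial_chains K d"
proof -
  have "{xs. x xs + y xs \<noteq> 0} \<subseteq> {xs. x xs \<noteq> 0} \<union> {xs. y xs \<noteq> 0}" by auto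
  then have "finite {xs. x xs + y xs \<noteq> 0}"
    using assms finite_subset unfolding simplicial_chains_def by blast
  moreover have "distinct xs \<and> set xs \<in> K \<and> int (length xs) = d + 1" if "x xs + y xs \<noteq> 0" for xs
  proof (cases "x xs = 0")
    case True
    with that chain_support[OF assms(2), of xs] show ?thesis by simp
  next
    case False
    with chain_support[OF assms(1), of xs] show ?thesis by simp
  qed
  ultimately show ?thesis
    using assms unfolding simplicial_chains_def by (simp add: distrib_left)
qed

lemma chains_diff:
  assumes "x \<in> simplicial_chains K d" "y \<in> simplicial_chains K d"
  shows "(\<lambda>xs. x xs - y xs) \<in> simplicial_chains K d"
  using chains_add[OF assms(1) chains_scale[OF assms(2), of "-1"]] by simp

section \<open>The boundary operator\<close>

lemma boundary_eq_sum:
  assumes "finite U" "\<And>v. c (v # ys) \<noteq> 0 \<Longrightarrow> v \<in> U"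
  shows "simplicial_boundary c ys = (\<Sum>v\<in>U. c (v # ys))"
  unfolding simplicial_boundary_def
  by (rule sum.mono_neutral_left) (use assms in auto)

text \<open>The index set in \<open>simplicial_boundary\<close> varies with the chain and with the
  list. Summing over one fixed finite set instead makes linearity and the exchange of sums
  immediate.\<close>

lemma chain_boundary_eq_sum:
  assumes "finite U" "\<And>xs. c xs \<noteq> 0 \<Longrightarrow> set xs \<subseteq> U"
  shows "simplicial_boundary c = (\<lambda>ys. \<Sum>v\<in>U. c (v # ys))"
proof
  fix ys
  show "simplicial_boundary c ys = (\<Sum>v\<in>U. c (v # ys))"
    by (rule boundary_eq_sum[OF assms(1)]) (use assms(2)[of "_ # ys"] in auto)
qed

lemma boundary_zero [simp]: "simplicial_boundary (\<lambda>_. 0) = (\<lambda>_. 0)"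
  unfolding simplicial_boundary_def by simp

lemma boundary_scale:
  "simplicial_boundary (\<lambda>xs. r * c xs) = (\<lambda>ys. r * simplicial_boundary c ys)"
  unfolding simplicial_boundary_def by (cases "r = 0") (auto simp: sum_distrib_left)

lemma boundary_add:
  assumes "x \<in> simplicial_chains K d" "y \<in> simplicial_chains M e"
  shows "simplicial_boundary (\<lambda>xs. x xs + y xs) =
    (\<lambda>ys. simplicial_boundary x ys + simplicial_boundary y ys)"
proof -
  obtain U where U: "finite U" "\<And>xs. x xs \<noteq> 0 \<Longrightarrow> set xs \<subseteq> U"
    using assms(1) by (rule chain_finite_vertices) blast
  obtain W where W: "finite W" "\<And>xs. y xs \<noteq> 0 \<Longrightarrow> set xs \<subseteq> W"
    using assms(2) by (rule chain_finite_vertices) blast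
  have F: "finite (U \<union> W)" using U W by simp
  have "set xs \<subseteq> U \<union> W" if "x xs + y xs \<noteq> 0" for xs
    using U(2)[of xs] W(2)[of xs] that by fastforce
  then show ?thesis
    using chain_boundary_eq_sum[OF F, of x] chain_boundary_eq_sum[OF F, of y]
      chain_boundary_eq_sum[OF F, of "\<lambda>xs. x xs + y xs"] U(2) W(2)
    by (simp add: sum.distrib le_supI1 le_supI2)
qed

lemma boundary_diff:
  assumes "x \<in> simplicial_chains K d" "y \<in> simplicial_chains M e"
  shows "simplicial_boundary (\<lambda>xs. x xs - y xs) =
    (\<lambda>ys. simplicial_boundary x ys - simplicial_boundary y ys)"
  using boundary_add[OF assms(1) chains_scale[OF assms(2), of "-1"]]
    boundary_scale[of "-1" y] by simp

text \<open>The row and the column of a new index cancel. The diagonal needs its own hypothesis,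
  since antisymmetry does not make it vanish in characteristic 2.\<close>

lemma antisymmetric_double_sum_eq_0:
  fixes f :: "'a \<Rightarrow> 'a \<Rightarrow> 'f::field"
  assumes "finite U" "\<And>v. f v v = 0" "\<And>v w. f v w = - f w v"
  shows "(\<Sum>v\<in>U. \<Sum>w\<in>U. f v w) = 0"
  using assms(1)
proof induction
  case (insert u U)
  have "(\<Sum>v\<in>U. f v u) = - (\<Sum>w\<in>U. f u w)"
    by (subst sum_negf[symmetric], rule sum.cong[OF refl]) (rule assms(3))
  with insert show ?case by (simp add: sum.distrib assms(2))
qed simp

text \<open>The boundary prepends a vertex, so applying it twice sums \<open>c (w # v # ys)\<close>
  over all \<open>v\<close> and \<open>w\<close>. This is antisymmetric, and its diagonal is 0
  because chains live on distinct lists.\<close>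

lemma boundary_boundary:
  assumes "c \<in> simplicial_chains K d"
  shows "simplicial_boundary (simplicial_boundary c) = (\<lambda>_. 0)"
proof
  fix ys
  obtain U where U: "finite U" "\<And>xs. c xs \<noteq> 0 \<Longrightarrow> set xs \<subseteq> U"
    using assms by (rule chain_finite_vertices) blast
  have b: "simplicial_boundary c = (\<lambda>ys. \<Sum>w\<in>U. c (w # ys))"
    using U by (rule chain_boundary_eq_sum)
  have "simplicial_boundary (simplicial_boundary c) ys = (\<Sum>v\<in>U. simplicial_boundary c (v # ys))"
  proof (rule boundary_eq_sum[OF U(1)])
    fix v assume "simplicial_boundary c (v # ys) \<noteq> 0"
    then obtain w where "c (w # v # ys) \<noteq> 0" unfolding b by (meson sum.neutral)
    then show "v \<in> U" using U(2) by fastforce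
  qed
  also have "\<dots> = (\<Sum>v\<in>U. \<Sum>w\<in>U. c (w # v # ys))" by (simp add: b)
  also have "\<dots> = 0"
  proof (rule antisymmetric_double_sum_eq_0[OF U(1)])
    show "c (v # v # ys) = 0" for v using chain_support(1)[OF assms, of "v # v # ys"] by auto
    show "c (w # v # ys) = - c (v # w # ys)" for v w
      using alternatingD[OF chain_alternating[OF assms], of "[]" w v ys] by simp
  qed
  finally show "simplicial_boundary (simplicial_boundary c) ys = 0" .
qed

lemma boundary_chain:
  fixes c :: "'v list \<Rightarrow> 'f::field"
  assumes c: "c \<in> simplicial_chains K (d + 1)" and fin: "finite (\<Union>K)"
    and down: "\<And>\<sigma> \<tau>. \<sigma> \<in> K \<Longrightarrow> \<tau> \<subseteq> \<sigma> \<Longrightarrow> \<tau> \<in> K"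
  shows "simplicial_boundary c \<in> simplicial_chains K d"
proof -
  obtain U where U: "finite U" "\<And>xs. c xs \<noteq> 0 \<Longrightarrow> set xs \<subseteq> U"
    using c by (rule chain_finite_vertices) blast
  have b: "simplicial_boundary c = (\<lambda>ys. \<Sum>w\<in>U. c (w # ys))"
    using U by (rule chain_boundary_eq_sum)
  have "distinct xs \<and> set xs \<in> K \<and> int (length xs) = d + 1" if "simplicial_boundary c xs \<noteq> 0" for xs
  proof -
    from that obtain w where "c (w # xs) \<noteq> 0" unfolding b by (meson sum.neutral)
    from chain_support[OF c this] down[of "set (w # xs)" "set xs"] show ?thesis by auto
  qed
  moreover have "alternating (simplicial_boundary c)"
    unfolding alternating_def
  proof (intro allI)
    fix us :: "'v list" and x y vs
    have "c (w # us @ x # y # vs) = - c (w # us @ y # x # vs)" for w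
      using alternatingD[OF chain_alternating[OF c], of "w # us" x y vs] by simp
    then show "simplicial_boundary c (us @ x # y # vs) = - simplicial_boundary c (us @ y # x # vs)"
      by (simp add: b sum_negf)
  qed
  ultimately show ?thesis unfolding simplicial_chains_iff[OF fin] by blast
qed


section \<open>Coning off\<close>

text \<open>Unfolded, this is the sum over the positions i of \<open>a\<close> in the list of (-1)^i
  times \<open>c\<close> of the list with that entry deleted, the sign being that of moving
  \<open>a\<close> to the front. The recursion collects the entries already passed in the function
  argument.\<close>

primrec cone_eval :: "'v \<Rightarrow> 'v list \<Rightarrow> ('v list \<Rightarrow> 'f::field) \<Rightarrow> 'f" where
  "cone_eval a [] c = 0"
| "cone_eval a (z # zs) c = (if z = a then c zs else 0) - cone_eval a zs (\<lambda>ws. c (z # ws))"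

text \<open>On an oriented simplex, this is \<open>[v\<^sub>0, \<dots>, v\<^sub>d] \<mapsto> [a, v\<^sub>0, \<dots>, v\<^sub>d]\<close>, and 0 if \<open>a\<close> is a vertex.\<close>

definition cone_chain :: "'v \<Rightarrow> ('v list \<Rightarrow> 'f::field) \<Rightarrow> 'v list \<Rightarrow> 'f" where
  "cone_chain a c zs = (if distinct zs then cone_eval a zs c else 0)"

lemma cone_eval_uminus: "cone_eval a zs (\<lambda>ws. - c ws) = - cone_eval a zs c"
  by (induction zs arbitrary: c) auto

lemma cone_eval_sum: "cone_eval a zs (\<lambda>ws. \<Sum>v\<in>U. f v ws) = (\<Sum>v\<in>U. cone_eval a zs (f v))"
  by (induction zs arbitrary: f) (auto simp: sum_subtractf)

lemma cone_eval_notin: "a \<notin> set zs \<Longrightarrow> cone_eval a zs c = 0"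
  by (induction zs arbitrary: c) auto

lemma cone_eval_nonzero:
  assumes "cone_eval a zs c \<noteq> 0"
  shows "\<exists>ws. c ws \<noteq> 0 \<and> set zs = insert a (set ws) \<and> length zs = Suc (length ws)"
  using assms
proof (induction zs arbitrary: c)
  case (Cons z zs)
  show ?case
  proof (cases "cone_eval a zs (\<lambda>ws. c (z # ws)) = 0")
    case True
    with Cons.prems have "z = a" "c zs \<noteq> 0" by (auto split: if_splits)
    then show ?thesis by auto
  next
    case False
    from Cons.IH[OF this] obtain ws where "c (z # ws) \<noteq> 0" "set zs = insert a (set ws)"
      "length zs = Suc (length ws)" by blast
    then show ?thesis by (intro exI[of _ "z # ws"]) auto
  qed
qed simp

lemma cone_eval_alternating:
  assumes "alternating c"
  shows "cone_eval a (us @ x # y # vs) c = - cone_eval a (us @ y # x # vs) c"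
  using assms
proof (induction us arbitrary: c)
  case Nil
  have "(\<lambda>ws. c (x # y # ws)) = (\<lambda>ws. - c (y # x # ws))"
    using alternatingD[OF Nil, of "[]" x y] by (intro ext) (simp only: append_Nil)
  then show ?case by (simp add: cone_eval_uminus)
next
  case (Cons u us)
  have eq: "c (us @ x # y # vs) = - c (us @ y # x # vs)" using Cons.prems by (rule alternatingD)
  show ?case using Cons.IH[OF alternating_Cons[OF Cons.prems], of u] eq by simp
qed

text \<open>If \<open>a\<close> stands at position i, deleting it there and putting it back in front
  each contribute (-1)^i, and the signs cancel.\<close>

lemma cone_eval_apex:
  assumes "alternating c" "distinct ys" "a \<in> set ys"
  shows "cone_eval a ys (\<lambda>ws. c (a # ws)) = c ys"
  using assms
proof (induction ys arbitrary: c)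
  case (Cons z ys)
  show ?case
  proof (cases "z = a")
    case True
    then show ?thesis using Cons.prems by (simp add: cone_eval_notin)
  next
    case False
    have "(\<lambda>ws. c (a # z # ws)) = (\<lambda>ws. - c (z # a # ws))"
      using alternatingD[OF Cons.prems(1), of "[]" a z] by (intro ext) (simp only: append_Nil)
    then show ?thesis
      using Cons.IH[OF alternating_Cons[OF Cons.prems(1)], of z] Cons.prems False
      by (simp add: cone_eval_uminus)
  qed
qed simp

text \<open>This is \<partial>(a * c) = c - a * \<partial>c, valid also on simplices that contain
  \<open>a\<close>. Both terms are sums over a prepended vertex \<open>v\<close>, and the summands
  cancel except for \<open>v = a\<close>. If \<open>v\<close> is not in \<open>ys\<close>, this is
  the recursion of \<open>cone_eval\<close>. If it is, the first summand is 0 by distinctness; the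
  second is 0 for \<open>v \<noteq> a\<close>, and for \<open>v = a\<close> it is
  \<open>c ys\<close> by \<open>cone_eval_apex\<close>.\<close>

lemma cone_homotopy:
  assumes c: "c \<in> simplicial_chains K d"
  shows "simplicial_boundary (cone_chain a c) ys + cone_chain a (simplicial_boundary c) ys = c ys"
proof -
  obtain U0 where U0: "finite U0" "\<And>xs. c xs \<noteq> 0 \<Longrightarrow> set xs \<subseteq> U0"
    using c by (rule chain_finite_vertices) blast
  define U where "U = insert a U0"
  have U: "finite U" "\<And>xs. c xs \<noteq> 0 \<Longrightarrow> set xs \<subseteq> U" "a \<in> U"
    using U0 unfolding U_def by auto
  have b: "simplicial_boundary c = (\<lambda>ys. \<Sum>w\<in>U. c (w # ys))"
    using U(1,2) by (rule chain_boundary_eq_sum)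
  have bc: "simplicial_boundary (cone_chain a c) ys = (\<Sum>v\<in>U. cone_chain a c (v # ys))"
  proof (rule boundary_eq_sum[OF U(1)])
    fix v assume "cone_chain a c (v # ys) \<noteq> 0"
    then have "cone_eval a (v # ys) c \<noteq> 0" unfolding cone_chain_def by presburger
    from cone_eval_nonzero[OF this] U(2,3) show "v \<in> U"
      by (metis insert_subset list.simps(15) insert_absorb)
  qed
  show ?thesis
  proof (cases "distinct ys")
    case False
    then show ?thesis using chain_support(1)[OF c, of ys] bc by (auto simp: cone_chain_def)
  next
    case True
    have *: "cone_chain a c (v # ys) + cone_eval a ys (\<lambda>ws. c (v # ws)) = (if v = a then c ys else 0)"
      for v
    proof (cases "v \<in> set ys")
      case False
      then show ?thesis using True by (simp add: cone_chain_def)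
    next
      case v: True
      have "cone_eval a ys (\<lambda>ws. c (v # ws)) = 0" if "v \<noteq> a"
      proof (rule ccontr)
        assume "cone_eval a ys (\<lambda>ws. c (v # ws)) \<noteq> 0"
        from cone_eval_nonzero[OF this] obtain ws where
          "c (v # ws) \<noteq> 0" "set ys = insert a (set ws)" by blast
        then show False using chain_support(1)[OF c, of "v # ws"] v that by auto
      qed
      then show ?thesis
        using v True cone_eval_apex[OF chain_alternating[OF c] True] by (auto simp: cone_chain_def)
    qed
    have "cone_chain a (simplicial_boundary c) ys = (\<Sum>v\<in>U. cone_eval a ys (\<lambda>ws. c (v # ws)))"
      using True by (simp add: cone_chain_def b cone_eval_sum)
    then have "simplicial_boundary (cone_chain a c) ys + cone_chain a (simplicial_boundary c) ys
      = (\<Sum>v\<in>U. if v = a then c ys else 0)"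
      using bc * by (simp add: sum.distrib[symmetric])
    then show ?thesis using U by simp
  qed
qed

lemma alternating_cone_chain:
  fixes c :: "'v list \<Rightarrow> 'f::field"
  shows "alternating c \<Longrightarrow> alternating (cone_chain a c)"
  unfolding alternating_def[of "cone_chain a c"]
proof (intro allI)
  assume "alternating c"
  fix us :: "'v list" and x y vs
  have "distinct (us @ x # y # vs) \<longleftrightarrow> distinct (us @ y # x # vs)" by auto
  then show "cone_chain a c (us @ x # y # vs) = - cone_chain a c (us @ y # x # vs)"
    using cone_eval_alternating[OF \<open>alternating c\<close>, of a us x y vs] unfolding cone_chain_def by simp
qed

lemma cone_chain_nonzero:
  assumes "cone_chain a c zs \<noteq> 0"
  shows "distinct zs" "\<exists>ws. c ws \<noteq> 0 \<and> set zs = insert a (set ws) \<and> length zs = Suc (length ws)"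
  using assms cone_eval_nonzero[of a zs c] unfolding cone_chain_def by presburger+


section \<open>Relative acyclicity\<close>

text \<open>The vanishing of the relative homology of the pair (M, K) in every degree, written
  without quotient complexes: every relative cycle is a chain of \<open>K\<close> up to a boundary.
  The type argument fixes the coefficient field, which the two complexes do not mention.\<close>

definition rel_acyclic :: "'f::field itself \<Rightarrow> 'v set set \<Rightarrow> 'v set set \<Rightarrow> bool" where
  "rel_acyclic T K M \<longleftrightarrow> (\<forall>d. \<forall>x :: 'v list \<Rightarrow> 'f.
     x \<in> simplicial_chains M d \<longrightarrow> simplicial_boundary x \<in> simplicial_chains K (d - 1) \<longrightarrow>
     (\<exists>y \<in> simplicial_chains M (d + 1). (\<lambda>xs. x xs - simplicial_boundary y xs) \<in> simplicial_chains K d))"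

lemma rel_acyclicD:
  fixes x :: "'v list \<Rightarrow> 'f::field"
  assumes "rel_acyclic TYPE('f) K M" "x \<in> simplicial_chains M d"
    "simplicial_boundary x \<in> simplicial_chains K (d - 1)"
  obtains y where "y \<in> simplicial_chains M (d + 1)"
    "(\<lambda>xs. x xs - simplicial_boundary y xs) \<in> simplicial_chains K d"
  using assms unfolding rel_acyclic_def by blast

lemma rel_acyclic_refl: "rel_acyclic T K K"
  unfolding rel_acyclic_def by (auto intro!: bexI[of _ "\<lambda>_. 0"] chains_zero)

text \<open>The part of the exact sequence of a triple that is needed: a relative cycle is moved
  into \<open>L\<close> and then, being still a cycle modulo \<open>K\<close>, from \<open>L\<close>
  into \<open>K\<close>. The two correcting chains add up.\<close>

lemma rel_acyclic_trans:
  fixes M :: "'v set set"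
  assumes KL: "rel_acyclic TYPE('f::field) K L" and LM: "rel_acyclic TYPE('f) L M"
    and "K \<subseteq> L" "L \<subseteq> M"
    and fin: "finite (\<Union>M)" and down: "\<And>\<sigma> \<tau>. \<sigma> \<in> M \<Longrightarrow> \<tau> \<subseteq> \<sigma> \<Longrightarrow> \<tau> \<in> M"
  shows "rel_acyclic TYPE('f) K M"
  unfolding rel_acyclic_def
proof (intro allI impI)
  fix d and x :: "'v list \<Rightarrow> 'f"
  assume x: "x \<in> simplicial_chains M d" and bx: "simplicial_boundary x \<in> simplicial_chains K (d - 1)"
  have "simplicial_boundary x \<in> simplicial_chains L (d - 1)"
    using bx chains_mono[OF \<open>K \<subseteq> L\<close>] by blast
  with LM x obtain y where y: "y \<in> simplicial_chains M (d + 1)"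
    "(\<lambda>xs. x xs - simplicial_boundary y xs) \<in> simplicial_chains L d" by (rule rel_acyclicD)
  have by': "simplicial_boundary y \<in> simplicial_chains M d"
    using y(1) fin down by (rule boundary_chain)
  have "simplicial_boundary (\<lambda>xs. x xs - simplicial_boundary y xs) = simplicial_boundary x"
    using boundary_diff[OF x by'] boundary_boundary[OF y(1)] by simp
  with bx have "simplicial_boundary (\<lambda>xs. x xs - simplicial_boundary y xs)
      \<in> simplicial_chains K (d - 1)" by simp
  with KL y(2) obtain y' where y': "y' \<in> simplicial_chains L (d + 1)"
    "(\<lambda>xs. x xs - simplicial_boundary y xs - simplicial_boundary y' xs) \<in> simplicial_chains K d"
    by (rule rel_acyclicD)
  have y'M: "y' \<in> simplicial_chains M (d + 1)" using y'(1) chains_mono[OF \<open>L \<subseteq> M\<close>] by blast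
  show "\<exists>y\<in>simplicial_chains M (d + 1). (\<lambda>xs. x xs - simplicial_boundary y xs) \<in> simplicial_chains K d"
  proof (rule bexI[OF _ chains_add[OF y(1) y'M]])
    show "(\<lambda>xs. x xs - simplicial_boundary (\<lambda>xs. y xs + y' xs) xs) \<in> simplicial_chains K d"
      using y'(2) by (simp add: boundary_add[OF y(1) y'M] diff_diff_eq)
  qed
qed

text \<open>If \<open>x'\<close> is the part of \<open>x\<close> on the star of \<open>\<sigma>\<close>, then \<open>x - \<partial>(a * x') = (x - x') + a * \<partial>x'\<close>
  avoids the star, since \<open>\<partial>x'\<close> agrees with \<open>\<partial>x\<close> there.\<close>

lemma rel_acyclic_delete_star:
  fixes M :: "'v set set"
  assumes fin: "finite (\<Union>M)" and down: "\<And>\<sigma> \<tau>. \<sigma> \<in> M \<Longrightarrow> \<tau> \<subseteq> \<sigma> \<Longrightarrow> \<tau> \<in> M"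
    and a: "a \<notin> \<sigma>" and cone: "\<And>\<tau>. \<tau> \<in> M \<Longrightarrow> \<sigma> \<subseteq> \<tau> \<Longrightarrow> insert a \<tau> \<in> M"
  shows "rel_acyclic TYPE('f::field) {\<tau> \<in> M. \<not> \<sigma> \<subseteq> \<tau>} M"
  unfolding rel_acyclic_def
proof (intro allI impI)
  let ?K = "{\<tau> \<in> M. \<not> \<sigma> \<subseteq> \<tau>}"
  fix d and x :: "'v list \<Rightarrow> 'f"
  assume x: "x \<in> simplicial_chains M d" and bx: "simplicial_boundary x \<in> simplicial_chains ?K (d - 1)"
  have finK: "finite (\<Union>?K)" using fin by (rule rev_finite_subset) auto
  define x' where "x' = (\<lambda>xs. if \<sigma> \<subseteq> set xs then x xs else 0)"
  have x': "x' \<in> simplicial_chains M d"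
    using chain_support[OF x] alternating_restrict[OF chain_alternating[OF x], of "\<lambda>s. \<sigma> \<subseteq> s"]
    unfolding simplicial_chains_iff[OF fin] x'_def by simp
  have bx'0: "\<not> \<sigma> \<subseteq> set ys" if "simplicial_boundary x' ys \<noteq> 0" for ys
  proof
    assume s: "\<sigma> \<subseteq> set ys"
    then have "x' (v # ys) = x (v # ys)" for v by (auto simp: x'_def)
    then have "simplicial_boundary x' ys = simplicial_boundary x ys"
      by (simp add: simplicial_boundary_def)
    with that chain_support(2)[OF bx, of ys] s show False by auto
  qed
  have bx': "simplicial_boundary x' \<in> simplicial_chains M (d - 1)"
    using x' by (intro boundary_chain[OF _ fin down]) auto
  have cone_x': "cone_chain a x' \<in> simplicial_chains M (d + 1)"
    unfolding simplicial_chains_iff[OF fin]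
  proof (intro conjI allI impI)
    show "alternating (cone_chain a x')"
      using chain_alternating[OF x'] by (rule alternating_cone_chain)
    fix zs assume nz: "cone_chain a x' zs \<noteq> 0"
    from cone_chain_nonzero(2)[OF nz] obtain ws where ws: "x' ws \<noteq> 0"
      "set zs = insert a (set ws)" "length zs = Suc (length ws)" by blast
    have "\<sigma> \<subseteq> set ws" using ws(1) by (auto simp: x'_def split: if_splits)
    then show "set zs \<in> M" "int (length zs) = d + 1 + 1" "distinct zs"
      using ws cone[of "set ws"] chain_support[OF x' ws(1)] cone_chain_nonzero(1)[OF nz] by auto
  qed
  have eq: "x xs - simplicial_boundary (cone_chain a x') xs
      = (x xs - x' xs) + cone_chain a (simplicial_boundary x') xs" for xs
    using cone_homotopy[OF x', of a xs] by (simp add: algebra_simps)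
  have "(\<lambda>xs. x xs - x' xs) = (\<lambda>xs. if \<not> \<sigma> \<subseteq> set xs then x xs else 0)"
    by (auto simp: x'_def)
  moreover have "(\<lambda>xs. if \<not> \<sigma> \<subseteq> set xs then x xs else 0) \<in> simplicial_chains ?K d"
    using chain_support[OF x] alternating_restrict[OF chain_alternating[OF x], of "\<lambda>s. \<not> \<sigma> \<subseteq> s"]
    unfolding simplicial_chains_iff[OF finK] by simp
  ultimately have "(\<lambda>xs. x xs - x' xs) \<in> simplicial_chains ?K d" by simp
  moreover have "cone_chain a (simplicial_boundary x') \<in> simplicial_chains ?K d"
    unfolding simplicial_chains_iff[OF finK]
  proof (intro conjI allI impI)
    show "alternating (cone_chain a (simplicial_boundary x'))"
      using chain_alternating[OF bx'] by (rule alternating_cone_chain)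
    fix zs assume nz: "cone_chain a (simplicial_boundary x') zs \<noteq> 0"
    from cone_chain_nonzero(2)[OF nz] obtain ws where ws: "simplicial_boundary x' ws \<noteq> 0"
      "set zs = insert a (set ws)" "length zs = Suc (length ws)" by blast
    \<comment> \<open>\<open>ws\<close> itself need not contain \<sigma>, so \<open>cone\<close>
      does not apply to it. It is a face of \<open>v # ws\<close>, which does contain \<sigma>, and
      the coned face of the latter contains \<open>zs\<close>.\<close>
    obtain v where v: "x' (v # ws) \<noteq> 0"
      using ws(1) unfolding simplicial_boundary_def by (metis (mono_tags, lifting) mem_Collect_eq sum.neutral)
    then have "insert a (set (v # ws)) \<in> M"
      using chain_support(2)[OF x' v] by (intro cone) (auto simp: x'_def split: if_splits)
    then have "set zs \<in> M" by (rule down) (auto simp: ws)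
    then show "set zs \<in> ?K" using bx'0[OF ws(1)] a ws(2) by auto
    show "int (length zs) = d + 1" using ws(3) chain_support(3)[OF bx' ws(1)] by simp
    show "distinct zs" using nz by (rule cone_chain_nonzero)
  qed
  ultimately have "(\<lambda>xs. x xs - simplicial_boundary (cone_chain a x') xs) \<in> simplicial_chains ?K d"
    unfolding eq by (rule chains_add)
  with cone_x' show "\<exists>y\<in>simplicial_chains M (d + 1).
      (\<lambda>xs. x xs - simplicial_boundary y xs) \<in> simplicial_chains ?K d" by blast
qed

section \<open>Transport along injective vertex maps and group actions\<close>

text \<open>Extension by zero: \<open>inv g\<close> is consulted only on the range of
  \<open>g\<close>, where it is a true inverse for injective \<open>g\<close>.\<close>

definition push_chain :: "('v \<Rightarrow> 'u) \<Rightarrow> ('v list \<Rightarrow> 'f::field) \<Rightarrow> 'u list \<Rightarrow> 'f" where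
  "push_chain g c xs = (if set xs \<subseteq> range g then c (map (inv g) xs) else 0)"

lemma push_chain_map: "inj g \<Longrightarrow> push_chain g c (map g xs) = c xs"
  unfolding push_chain_def by (auto simp: o_def)

lemma list_in_rangeE:
  assumes "set xs \<subseteq> range g"
  obtains zs where "xs = map g zs"
  using assms ex_map_conv[of xs g] by blast

lemma push_chain_nonzeroE:
  assumes "inj g" "push_chain g c xs \<noteq> 0"
  obtains zs where "xs = map g zs" "c zs \<noteq> 0"
proof -
  from assms(2) have "set xs \<subseteq> range g" by (auto simp: push_chain_def split: if_splits)
  then obtain zs where "xs = map g zs" by (rule list_in_rangeE)
  then show thesis using that assms by (simp add: push_chain_map)
qed

lemma push_chain_in_chains:
  assumes g: "inj g" and fin: "finite (\<Union>K)" and c: "c \<in> simplicial_chains K d"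
  shows "push_chain g c \<in> simplicial_chains ((`) g ` K) d"
proof -
  have "\<Union>((`) g ` K) = g ` \<Union>K" by blast
  then have fin': "finite (\<Union>((`) g ` K))" using fin by simp
  show ?thesis unfolding simplicial_chains_iff[OF fin']
  proof (intro conjI allI impI)
    fix xs assume "push_chain g c xs \<noteq> 0"
    then obtain zs where zs: "xs = map g zs" "c zs \<noteq> 0" using g push_chain_nonzeroE by metis
    then show "distinct xs" "set xs \<in> (`) g ` K" "int (length xs) = d + 1"
      using chain_support[OF c zs(2)] inj_on_subset[OF g subset_UNIV] by (auto simp: distinct_map)
  next
    show "alternating (push_chain g c)"
    proof (rule alternatingI)
      fix us x y vs
      show "push_chain g c (us @ x # y # vs) = - push_chain g c (us @ y # x # vs)"
        using alternatingD[OF chain_alternating[OF c], of "map (inv g) us" "inv g x" "inv g y"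
            "map (inv g) vs"]
        unfolding push_chain_def by auto
    qed
  qed
qed

text \<open>A list with an entry outside the range of \<open>g\<close> spans no face of the image
  complex, so pulling back along \<open>map g\<close> loses nothing. This returns chains found in
  the common complex to the original vertex type.\<close>

lemma push_chain_surj:
  assumes g: "inj g" and fin: "finite (\<Union>K)" and x: "x \<in> simplicial_chains ((`) g ` K) d"
  obtains c where "c \<in> simplicial_chains K d" "x = push_chain g c"
proof
  show "(\<lambda>xs. x (map g xs)) \<in> simplicial_chains K d"
    unfolding simplicial_chains_iff[OF fin]
  proof (intro conjI allI impI)
    fix xs assume nz: "x (map g xs) \<noteq> 0"
    show "distinct xs" "int (length xs) = d + 1"
      using chain_support[OF x nz] by (auto simp: distinct_map)
    from chain_support(2)[OF x nz] obtain F where "F \<in> K" "g ` set xs = g ` F" by auto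
    then show "set xs \<in> K" using g by (simp add: inj_image_eq_iff)
  next
    show "alternating (\<lambda>xs. x (map g xs))"
    proof (rule alternatingI)
      fix us v w vs
      show "x (map g (us @ v # w # vs)) = - x (map g (us @ w # v # vs))"
        using alternatingD[OF chain_alternating[OF x], of "map g us" "g v" "g w" "map g vs"] by simp
    qed
  qed
  show "x = push_chain g (\<lambda>xs. x (map g xs))"
  proof
    fix xs
    show "x xs = push_chain g (\<lambda>xs. x (map g xs)) xs"
    proof (cases "set xs \<subseteq> range g")
      case True
      then obtain zs where "xs = map g zs" by (rule list_in_rangeE)
      then show ?thesis by (simp add: push_chain_map[OF g])
    next
      case False
      then have "set xs \<notin> (`) g ` K" by blast
      then show ?thesis using False chain_support(2)[OF x, of xs] by (auto simp: push_chain_def)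
    qed
  qed
qed

lemma push_chain_inject:
  assumes "inj g" "push_chain g c = push_chain g c'"
  shows "c = c'"
proof
  fix xs show "c xs = c' xs" using fun_cong[OF assms(2), of "map g xs"] assms(1) by (simp add: push_chain_map)
qed

lemma push_chain_zero [simp]: "push_chain g (\<lambda>_. 0) = (\<lambda>_. 0)"
  by (auto simp: push_chain_def)

lemma push_chain_add:
  "push_chain g (\<lambda>xs. c xs + c' xs) = (\<lambda>xs. push_chain g c xs + push_chain g c' xs)"
  by (auto simp: push_chain_def)

lemma push_chain_scale: "push_chain g (\<lambda>xs. r * c xs) = (\<lambda>xs. r * push_chain g c xs)"
  by (auto simp: push_chain_def)

lemma boundary_push_chain:
  assumes g: "inj g" and c: "c \<in> simplicial_chains K d"
  shows "simplicial_boundary (push_chain g c) = push_chain g (simplicial_boundary c)"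
proof
  fix ys
  obtain U where U: "finite U" "\<And>xs. c xs \<noteq> 0 \<Longrightarrow> set xs \<subseteq> U"
    using c by (rule chain_finite_vertices) blast
  have "simplicial_boundary (push_chain g c) ys = (\<Sum>v\<in>g ` U. push_chain g c (v # ys))"
  proof (rule boundary_eq_sum)
    fix v assume "push_chain g c (v # ys) \<noteq> 0"
    then obtain zs where "v # ys = map g zs" "c zs \<noteq> 0" using g push_chain_nonzeroE by metis
    with U(2)[of zs] show "v \<in> g ` U" by (cases zs) auto
  qed (use U in simp)
  also have "\<dots> = (\<Sum>v\<in>U. push_chain g c (g v # ys))"
    using g by (subst sum.reindex) (auto intro: inj_on_subset)
  also have "\<dots> = push_chain g (simplicial_boundary c) ys"
    using g by (simp add: push_chain_def chain_boundary_eq_sum[of U c, OF U])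
  finally show "simplicial_boundary (push_chain g c) ys = push_chain g (simplicial_boundary c) ys" .
qed

text \<open>Precomposition is contravariant, which is why the group element \<open>s\<close> acts on
  homology by \<open>act_chain (a (inv s))\<close>.\<close>

definition act_chain :: "('v \<Rightarrow> 'v) \<Rightarrow> ('v list \<Rightarrow> 'f) \<Rightarrow> 'v list \<Rightarrow> 'f" where
  "act_chain h c xs = c (map h xs)"

lemma act_chain_zero [simp]: "act_chain h (\<lambda>_. 0) = (\<lambda>_. 0)"
  by (auto simp: act_chain_def)

lemma act_chain_in_chains:
  assumes "inj h" and fin: "finite (\<Union>K)" and c: "c \<in> simplicial_chains K d"
    and inv: "\<And>F. h ` F \<in> K \<Longrightarrow> F \<in> K"
  shows "act_chain h c \<in> simplicial_chains K d"
  unfolding simplicial_chains_iff[OF fin]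
proof (intro conjI allI impI)
  fix xs assume nz: "act_chain h c xs \<noteq> 0"
  then show "distinct xs" "int (length xs) = d + 1" "set xs \<in> K"
    using chain_support[OF c, of "map h xs"] inv[of "set xs"] by (auto simp: distinct_map act_chain_def)
next
  show "alternating (act_chain h c)"
  proof (rule alternatingI)
    fix us v w vs
    show "act_chain h c (us @ v # w # vs) = - act_chain h c (us @ w # v # vs)"
      using alternatingD[OF chain_alternating[OF c], of "map h us" "h v" "h w" "map h vs"]
      unfolding act_chain_def by simp
  qed
qed

lemma boundary_act_chain:
  assumes "bij h"
  shows "simplicial_boundary (act_chain h c) = act_chain h (simplicial_boundary c)"
proof
  fix ys
  have "bij_betw h {v. c (h v # map h ys) \<noteq> 0} {w. c (w # map h ys) \<noteq> 0}"
    using assms by (auto simp: bij_betw_def bij_def inj_on_def image_iff surj_def)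
  then show "simplicial_boundary (act_chain h c) ys = act_chain h (simplicial_boundary c) ys"
    unfolding simplicial_boundary_def act_chain_def
    by (simp add: sum.reindex_bij_betw[symmetric])
qed

lemma push_chain_act_chain:
  assumes "inj g" and "\<And>v. k (g v) = g (h v)" and "inj k" and "bij h"
  shows "push_chain g (act_chain h c) = act_chain k (push_chain g c)"
proof
  fix xs
  show "push_chain g (act_chain h c) xs = act_chain k (push_chain g c) xs"
  proof (cases "set xs \<subseteq> range g")
    case True
    then obtain zs where zs: "xs = map g zs" by (rule list_in_rangeE)
    have "map k (map g zs) = map g (map h zs)" using assms(2) by simp
    then show ?thesis by (simp add: zs act_chain_def push_chain_map assms(1) del: map_map)
  next
    case False
    then obtain x where x: "x \<in> set xs" "x \<notin> range g" by blast
    \<comment> \<open>Here surjectivity of \<open>h\<close> enters: it gives every point of the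
      range a \<open>k\<close>-preimage within the range, so an injective \<open>k\<close> cannot
      bring \<open>x\<close> there from outside.\<close>
    have "k x \<notin> range g"
    proof
      assume "k x \<in> range g"
      then obtain v where "k x = g v" by blast
      also obtain w where "v = h w" using \<open>bij h\<close> by (metis bij_pointE)
      finally have "k x = k (g w)" using assms(2) by simp
      with x(2) \<open>inj k\<close> show False by (auto dest: injD)
    qed
    with x(1) False show ?thesis by (auto simp: push_chain_def act_chain_def)
  qed
qed


section \<open>Comparison of homology inside a common complex\<close>

lemma cyclesD:
  assumes "z \<in> simplicial_cycles K d"
  shows "z \<in> simplicial_chains K d" "simplicial_boundary z = (\<lambda>_. 0)"
  using assms unfolding simplicial_cycles_def by auto

lemma cycles_add:
  assumes "x \<in> simplicial_cycles K d" "y \<in> simplicial_cycles K d"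
  shows "(\<lambda>xs. x xs + y xs) \<in> simplicial_cycles K d"
  using cyclesD[OF assms(1)] cyclesD[OF assms(2)] boundary_add[of x K d y K d] chains_add[of x K d y]
  unfolding simplicial_cycles_def by simp

lemma cycles_scale:
  "x \<in> simplicial_cycles K d \<Longrightarrow> (\<lambda>xs. r * x xs) \<in> simplicial_cycles K d"
  unfolding simplicial_cycles_def by (simp add: chains_scale boundary_scale)

lemma boundaries_zero: "(\<lambda>_. 0) \<in> simplicial_boundaries K d"
  unfolding simplicial_boundaries_def by (rule image_eqI[OF _ chains_zero]) simp

lemma boundaries_add:
  assumes "x \<in> simplicial_boundaries K d" "y \<in> simplicial_boundaries K d"
  shows "(\<lambda>xs. x xs + y xs) \<in> simplicial_boundaries K d"
proof -
  from assms obtain u v where u: "u \<in> simplicial_chains K (d + 1)" "x = simplicial_boundary u"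
    and v: "v \<in> simplicial_chains K (d + 1)" "y = simplicial_boundary v"
    unfolding simplicial_boundaries_def by blast
  show ?thesis unfolding simplicial_boundaries_def
    by (rule image_eqI[OF _ chains_add[OF u(1) v(1)]]) (simp add: boundary_add[OF u(1) v(1)] u(2) v(2))
qed

lemma boundaries_scale:
  "x \<in> simplicial_boundaries K d \<Longrightarrow> (\<lambda>xs. r * x xs) \<in> simplicial_boundaries K d"
  unfolding simplicial_boundaries_def
  by (elim imageE, rule image_eqI[OF _ chains_scale]) (simp_all add: boundary_scale)

section \<open>Homology classes as cosets\<close>

definition homology_class :: "'v set set \<Rightarrow> int \<Rightarrow> ('v list \<Rightarrow> 'f::field) \<Rightarrow> ('v list \<Rightarrow> 'f) set" where
  "homology_class K d z = {\<lambda>xs. z xs + b xs | b. b \<in> simplicial_boundaries K d}"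

lemma mem_homology_class:
  "x \<in> homology_class K d z \<longleftrightarrow> (\<lambda>xs. x xs - z xs) \<in> simplicial_boundaries K d"
proof
  assume "(\<lambda>xs. x xs - z xs) \<in> simplicial_boundaries K d"
  moreover have "x = (\<lambda>xs. z xs + (x xs - z xs))" by simp
  ultimately show "x \<in> homology_class K d z" unfolding homology_class_def
    by (intro CollectI exI[of _ "\<lambda>xs. x xs - z xs"] conjI)
qed (auto simp: homology_class_def)

lemma homology_class_eq_iff:
  "homology_class K d z = homology_class K d z' \<longleftrightarrow> (\<lambda>xs. z xs - z' xs) \<in> simplicial_boundaries K d"
proof
  assume "homology_class K d z = homology_class K d z'"
  moreover have "z \<in> homology_class K d z" by (simp add: mem_homology_class boundaries_zero)
  ultimately show "(\<lambda>xs. z xs - z' xs) \<in> simplicial_boundaries K d" by (simp add: mem_homology_class)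
next
  assume a: "(\<lambda>xs. z xs - z' xs) \<in> simplicial_boundaries K d"
  have "x \<in> homology_class K d z \<longleftrightarrow> x \<in> homology_class K d z'" for x
    using boundaries_add[OF a, of "\<lambda>xs. x xs - z xs"]
      boundaries_add[OF boundaries_scale[OF a, of "-1"], of "\<lambda>xs. x xs - z' xs"]
    by (auto simp: mem_homology_class algebra_simps)
  then show "homology_class K d z = homology_class K d z'" by blast
qed

lemma homology_class_add:
  "{\<lambda>xs. x xs + y xs | x y. x \<in> homology_class K d z \<and> y \<in> homology_class K d z'}
    = homology_class K d (\<lambda>xs. z xs + z' xs)" (is "?L = ?R")
proof (intro equalityI subsetI)
  fix u assume "u \<in> ?L"
  then obtain x y where xy: "u = (\<lambda>xs. x xs + y xs)" "x \<in> homology_class K d z" "y \<in> homology_class K d z'"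
    by blast
  from xy(2,3) boundaries_add[of "\<lambda>xs. x xs - z xs" K d "\<lambda>xs. y xs - z' xs"] show "u \<in> ?R"
    by (simp add: mem_homology_class xy(1) algebra_simps)
next
  fix u assume u: "u \<in> ?R"
  have "(\<lambda>xs. u xs - z' xs) \<in> homology_class K d z"
    using u by (simp add: mem_homology_class algebra_simps)
  moreover have "z' \<in> homology_class K d z'" by (simp add: mem_homology_class boundaries_zero)
  moreover have "u = (\<lambda>xs. (u xs - z' xs) + z' xs)" by simp
  ultimately show "u \<in> ?L"
    by (intro CollectI exI[of _ "\<lambda>xs. u xs - z' xs"] exI[of _ z'] conjI)
qed

lemma homology_class_scale:
  "{\<lambda>xs. r * x xs + b xs | x b. x \<in> homology_class K d z \<and> b \<in> simplicial_boundaries K d}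
    = homology_class K d (\<lambda>xs. r * z xs)" (is "?L = ?R")
proof (intro equalityI subsetI)
  fix u assume "u \<in> ?L"
  then obtain x b where xb: "u = (\<lambda>xs. r * x xs + b xs)" "x \<in> homology_class K d z"
    "b \<in> simplicial_boundaries K d" by blast
  from xb(2) have "(\<lambda>xs. r * (x xs - z xs)) \<in> simplicial_boundaries K d"
    unfolding mem_homology_class by (rule boundaries_scale)
  from boundaries_add[OF this xb(3)] show "u \<in> ?R"
    by (simp add: mem_homology_class xb(1) algebra_simps)
next
  fix u assume u: "u \<in> ?R"
  have "z \<in> homology_class K d z" by (simp add: mem_homology_class boundaries_zero)
  moreover have "u = (\<lambda>xs. r * z xs + (u xs - r * z xs))" by simp
  ultimately show "u \<in> ?L" using u unfolding mem_homology_class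
    by (intro CollectI exI[of _ z] exI[of _ "\<lambda>xs. u xs - r * z xs"] conjI)
qed

text \<open>The module action is the image of a coset, so equality of sets is required. The
  inclusion from right to left takes a representative back by \<open>h'\<close>, which also
  preserves boundaries.\<close>

lemma act_homology_class:
  fixes K :: "'v set set"
  assumes h: "bij h" and h': "bij h'" and inverse: "\<And>v. h (h' v) = v"
    and fin: "finite (\<Union>K)"
    and inv: "\<And>F. h ` F \<in> K \<Longrightarrow> F \<in> K" "\<And>F. h' ` F \<in> K \<Longrightarrow> F \<in> K"
  shows "act_chain h ` homology_class K d z = homology_class K d (act_chain h z)"
proof -
  have B: "act_chain k b \<in> simplicial_boundaries K d"
    if b: "b \<in> simplicial_boundaries K d" and k: "bij k" "\<And>F. k ` F \<in> K \<Longrightarrow> F \<in> K"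
    for k and b :: "'v list \<Rightarrow> 'f::field"
  proof -
    from b obtain u where u: "u \<in> simplicial_chains K (d + 1)" "b = simplicial_boundary u"
      unfolding simplicial_boundaries_def by blast
    show ?thesis unfolding simplicial_boundaries_def u(2) boundary_act_chain[OF k(1), symmetric]
      using act_chain_in_chains[OF bij_is_inj[OF k(1)] fin u(1) k(2)] by blast
  qed
  show ?thesis
  proof (intro equalityI subsetI)
    fix u assume "u \<in> act_chain h ` homology_class K d z"
    then obtain x where x: "u = act_chain h x" "x \<in> homology_class K d z" by blast
    from B[OF x(2)[unfolded mem_homology_class] h inv(1)]
    show "u \<in> homology_class K d (act_chain h z)"
      unfolding mem_homology_class x(1) act_chain_def .
  next
    fix u assume "u \<in> homology_class K d (act_chain h z)"
    from B[OF this[unfolded mem_homology_class] h' inv(2)]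
    have "act_chain h' u \<in> homology_class K d z"
      using inverse unfolding mem_homology_class act_chain_def by (simp add: o_def)
    moreover have "h' (h v) = v" for v using inverse h' by (metis bij_pointE)
    then have "u = act_chain h (act_chain h' u)" by (intro ext) (simp add: act_chain_def o_def)
    ultimately show "u \<in> act_chain h ` homology_class K d z" by blast
  qed
qed

lemma reduced_homology_simps:
  "gcarrier (reduced_homology a K d) = homology_class K d ` simplicial_cycles K d"
  "gadd (reduced_homology a K d) = (\<lambda>A B. {\<lambda>xs. x xs + y xs | x y. x \<in> A \<and> y \<in> B})"
  "gscale (reduced_homology a K d) =
     (\<lambda>r A. {\<lambda>xs. r * x xs + b xs | x b. x \<in> A \<and> b \<in> simplicial_boundaries K d})"
  "gact (reduced_homology a K d) s A = act_chain (a (inv s)) ` A"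
  unfolding reduced_homology_def homology_class_def act_chain_def by simp_all

text \<open>A zigzag of embeddings of \<open>K1\<close> and \<open>K2\<close> in \<open>M\<close>,
  both inducing isomorphisms on homology. The vertex maps allow three different vertex types;
  \<open>T\<close> fixes the coefficients.\<close>

locale common_complex =
  fixes K1 :: "'v set set" and K2 :: "'w set set" and M :: "'u set set"
    and g1 :: "'v \<Rightarrow> 'u" and g2 :: "'w \<Rightarrow> 'u" and T :: "'f::field itself"
  assumes inj: "inj g1" "inj g2"
    and fin: "finite (\<Union>K1)" "finite (\<Union>K2)" "finite (\<Union>M)"
    and down1: "\<sigma> \<in> K1 \<Longrightarrow> \<tau> \<subseteq> \<sigma> \<Longrightarrow> \<tau> \<in> K1"
    and down2: "\<sigma>' \<in> K2 \<Longrightarrow> \<tau>' \<subseteq> \<sigma>' \<Longrightarrow> \<tau>' \<in> K2"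
    and downM: "\<rho> \<in> M \<Longrightarrow> \<pi> \<subseteq> \<rho> \<Longrightarrow> \<pi> \<in> M"
    and sub: "(`) g1 ` K1 \<subseteq> M" "(`) g2 ` K2 \<subseteq> M"
    and acyclic: "rel_acyclic T ((`) g1 ` K1) M" "rel_acyclic T ((`) g2 ` K2) M"
begin

text \<open>The composite of H(K1) \<rightarrow> H(M) with the inverse of H(K2) \<rightarrow> H(M),
  as a relation between cycles. A relation needs no chosen inverse, and it visibly respects sums,
  multiples and the group action.\<close>

definition homologous :: "int \<Rightarrow> ('v list \<Rightarrow> 'f) \<Rightarrow> ('w list \<Rightarrow> 'f) \<Rightarrow> bool" where
  "homologous d z w \<longleftrightarrow> z \<in> simplicial_cycles K1 d \<and> w \<in> simplicial_cycles K2 d \<and>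
     (\<lambda>xs. push_chain g1 z xs - push_chain g2 w xs) \<in> simplicial_boundaries M d"

lemma common_complex_swap: "common_complex K2 K1 M g2 g1 T"
  by unfold_locales (use inj fin down1 down2 downM sub acyclic in auto)

lemma acyclic': "rel_acyclic TYPE('f) ((`) g1 ` K1) M" "rel_acyclic TYPE('f) ((`) g2 ` K2) M"
  using acyclic unfolding rel_acyclic_def by auto

lemma push_in_M:
  "c \<in> simplicial_chains K1 d \<Longrightarrow> push_chain g1 c \<in> simplicial_chains M d"
  "c' \<in> simplicial_chains K2 d \<Longrightarrow> push_chain g2 c' \<in> simplicial_chains M d"
  by (rule subsetD[OF chains_mono[OF sub(1)] push_chain_in_chains[OF inj(1) fin(1)]],
      assumption)
    (rule subsetD[OF chains_mono[OF sub(2)] push_chain_in_chains[OF inj(2) fin(2)]])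

text \<open>Surjectivity of H(K2) \<rightarrow> H(M): a cycle of \<open>M\<close> is in particular a
  cycle relative to \<open>K2\<close>, hence homologous to a chain of \<open>K2\<close>, which is
  again a cycle.\<close>

lemma homologous_total:
  assumes z: "z \<in> simplicial_cycles K1 d"
  obtains w where "homologous d z w"
proof -
  note zc = cyclesD[OF z]
  have z': "push_chain g1 z \<in> simplicial_chains M d" using zc(1) by (rule push_in_M)
  have bz: "simplicial_boundary (push_chain g1 z) = (\<lambda>_. 0)"
    using boundary_push_chain[OF inj(1) zc(1)] zc(2) by simp
  then have "simplicial_boundary (push_chain g1 z) \<in> simplicial_chains ((`) g2 ` K2) (d - 1)"
    by (simp add: chains_zero)
  with acyclic'(2) z' obtain y where y: "y \<in> simplicial_chains M (d + 1)"
    "(\<lambda>xs. push_chain g1 z xs - simplicial_boundary y xs) \<in> simplicial_chains ((`) g2 ` K2) d"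
    by (rule rel_acyclicD)
  from push_chain_surj[OF inj(2) fin(2) y(2)] obtain w where w: "w \<in> simplicial_chains K2 d"
    "(\<lambda>xs. push_chain g1 z xs - simplicial_boundary y xs) = push_chain g2 w" by blast
  have "push_chain g2 (simplicial_boundary w) = simplicial_boundary (push_chain g2 w)"
    using boundary_push_chain[OF inj(2) w(1)] by simp
  also have "\<dots> = (\<lambda>_. 0)"
    unfolding w(2)[symmetric]
    using boundary_diff[OF z' boundary_chain[OF y(1) fin(3) downM]] bz boundary_boundary[OF y(1)]
    by simp
  finally have "simplicial_boundary w = (\<lambda>_. 0)"
    by (intro push_chain_inject[OF inj(2)]) simp
  with w(1) have "w \<in> simplicial_cycles K2 d" unfolding simplicial_cycles_def by simp
  moreover have "(\<lambda>xs. push_chain g1 z xs - push_chain g2 w xs) = simplicial_boundary y"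
    by (rule ext) (use fun_cong[OF w(2)] in \<open>simp add: algebra_simps\<close>)
  ultimately have "homologous d z w"
    using z y(1) unfolding homologous_def simplicial_boundaries_def by auto
  then show thesis by (rule that)
qed

text \<open>Injectivity of H(K2) \<rightarrow> H(M). If \<open>z\<close> is the boundary of
  \<open>b\<close>, then \<open>w\<close> bounds \<open>b - y\<close> in \<open>M\<close>; this is a
  cycle relative to \<open>K2\<close>, so subtracting a boundary moves it into \<open>K2\<close>,
  and its own boundary remains \<open>w\<close>.\<close>

lemma homologous_boundary:
  assumes "homologous d z w" and z: "z \<in> simplicial_boundaries K1 d"
  shows "w \<in> simplicial_boundaries K2 d"
proof -
  from assms(1) obtain y where w: "w \<in> simplicial_cycles K2 d" and y: "y \<in> simplicial_chains M (d + 1)"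
    "(\<lambda>xs. push_chain g1 z xs - push_chain g2 w xs) = simplicial_boundary y"
    unfolding homologous_def simplicial_boundaries_def by auto
  from z obtain b where b: "b \<in> simplicial_chains K1 (d + 1)" "z = simplicial_boundary b"
    unfolding simplicial_boundaries_def by blast
  note b' = push_in_M(1)[OF b(1)]
  have "simplicial_boundary (\<lambda>xs. push_chain g1 b xs - y xs) = push_chain g2 w"
    unfolding boundary_diff[OF b' y(1)] boundary_push_chain[OF inj(1) b(1)] b(2)[symmetric]
    by (rule ext) (use fun_cong[OF y(2)] in \<open>simp add: algebra_simps\<close>)
  note bd = this
  \<comment> \<open>The degree is left as \<open>d + 1 - 1\<close> to match the pattern
    \<open>d - 1\<close> of \<open>rel_acyclicD\<close>, used in degree
    \<open>d + 1\<close>.\<close>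
  have "push_chain g2 w \<in> simplicial_chains ((`) g2 ` K2) (d + 1 - 1)"
    using push_chain_in_chains[OF inj(2) fin(2) cyclesD(1)[OF w]] by simp
  then have "simplicial_boundary (\<lambda>xs. push_chain g1 b xs - y xs)
      \<in> simplicial_chains ((`) g2 ` K2) (d + 1 - 1)" by (simp only: bd)
  with acyclic'(2) chains_diff[OF b' y(1)] obtain y' where y': "y' \<in> simplicial_chains M (d + 1 + 1)"
    "(\<lambda>xs. push_chain g1 b xs - y xs - simplicial_boundary y' xs) \<in> simplicial_chains ((`) g2 ` K2) (d + 1)"
    by (rule rel_acyclicD)
  from push_chain_surj[OF inj(2) fin(2) y'(2)] obtain u where u: "u \<in> simplicial_chains K2 (d + 1)"
    "(\<lambda>xs. push_chain g1 b xs - y xs - simplicial_boundary y' xs) = push_chain g2 u" by blast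
  have "push_chain g2 (simplicial_boundary u) = simplicial_boundary (push_chain g2 u)"
    using boundary_push_chain[OF inj(2) u(1)] by simp
  also have "\<dots> = push_chain g2 w"
    unfolding u(2)[symmetric]
    using boundary_diff[OF chains_diff[OF b' y(1)] boundary_chain[OF y'(1) fin(3) downM]]
      bd boundary_boundary[OF y'(1)] by simp
  finally have "simplicial_boundary u = w" by (rule push_chain_inject[OF inj(2)])
  then show ?thesis unfolding simplicial_boundaries_def using u(1) by blast
qed

lemma homologous_add:
  assumes "homologous d z w" "homologous d z' w'"
  shows "homologous d (\<lambda>xs. z xs + z' xs) (\<lambda>xs. w xs + w' xs)"
  using assms cycles_add[of z K1 d z'] cycles_add[of w K2 d w']
    boundaries_add[of "\<lambda>xs. push_chain g1 z xs - push_chain g2 w xs" M d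
      "\<lambda>xs. push_chain g1 z' xs - push_chain g2 w' xs"]
  unfolding homologous_def push_chain_add by (simp add: algebra_simps)

lemma homologous_scale:
  assumes "homologous d z w"
  shows "homologous d (\<lambda>xs. r * z xs) (\<lambda>xs. r * w xs)"
  using assms cycles_scale[of z K1 d r] cycles_scale[of w K2 d r]
    boundaries_scale[of "\<lambda>xs. push_chain g1 z xs - push_chain g2 w xs" M d r]
  unfolding homologous_def push_chain_scale by (simp add: algebra_simps)

lemma homologous_diff:
  assumes "homologous d z w" "homologous d z' w'"
  shows "homologous d (\<lambda>xs. z xs - z' xs) (\<lambda>xs. w xs - w' xs)"
  using homologous_add[OF assms(1) homologous_scale[OF assms(2), of "-1"]] by simp

lemma homologous_commute:
  "common_complex.homologous K2 K1 M g2 g1 d w z \<longleftrightarrow> homologous d z w"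
proof -
  interpret sw: common_complex K2 K1 M g2 g1 T by (rule common_complex_swap)
  have "(\<lambda>xs. x xs - y xs) \<in> simplicial_boundaries M d \<Longrightarrow> (\<lambda>xs. y xs - x xs) \<in> simplicial_boundaries M d"
    for x y :: "'u list \<Rightarrow> 'f"
    using boundaries_scale[of "\<lambda>xs. x xs - y xs" M d "-1"] by simp
  then show ?thesis unfolding homologous_def sw.homologous_def by blast
qed

lemma homologous_total':
  assumes "w \<in> simplicial_cycles K2 d"
  obtains z where "homologous d z w"
proof -
  interpret sw: common_complex K2 K1 M g2 g1 T by (rule common_complex_swap)
  show thesis using sw.homologous_total[OF assms] that homologous_commute by metis
qed

lemma homologous_boundary':
  assumes "homologous d z w" "w \<in> simplicial_boundaries K2 d"
  shows "z \<in> simplicial_boundaries K1 d"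
proof -
  interpret sw: common_complex K2 K1 M g2 g1 T by (rule common_complex_swap)
  show ?thesis using sw.homologous_boundary assms homologous_commute by metis
qed

text \<open>From left to right this makes the induced map on classes well defined, from right to
  left injective.\<close>

lemma homologous_class_eq_iff:
  assumes "homologous d z w" "homologous d z' w'"
  shows "homology_class K1 d z = homology_class K1 d z' \<longleftrightarrow> homology_class K2 d w = homology_class K2 d w'"
  unfolding homology_class_eq_iff
  using homologous_diff[OF assms] homologous_boundary homologous_boundary' by blast

text \<open>Equivariance comes from \<open>M\<close>: if \<open>y\<close> bounds the difference of
  two corresponding cycles, its translate bounds the difference of their translates.\<close>

lemma gmodule_isomorphic_homology:
  fixes a1 :: "('x \<Rightarrow> 'x) \<Rightarrow> 'v \<Rightarrow> 'v" and a2 :: "('x \<Rightarrow> 'x) \<Rightarrow> 'w \<Rightarrow> 'w"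
    and aM :: "('x \<Rightarrow> 'x) \<Rightarrow> 'u \<Rightarrow> 'u"
  assumes Ginv: "\<And>s. s \<in> G \<Longrightarrow> inv s \<in> G" "\<And>s. s \<in> G \<Longrightarrow> inv (inv s) = s"
    and inverse: "\<And>s v. s \<in> G \<Longrightarrow> a1 (inv s) (a1 s v) = v" "\<And>s v. s \<in> G \<Longrightarrow> a2 (inv s) (a2 s v) = v"
      "\<And>s v. s \<in> G \<Longrightarrow> aM (inv s) (aM s v) = v"
    and inv: "\<And>s F. s \<in> G \<Longrightarrow> F \<in> K1 \<Longrightarrow> a1 s ` F \<in> K1" "\<And>s F. s \<in> G \<Longrightarrow> F \<in> K2 \<Longrightarrow> a2 s ` F \<in> K2"
      "\<And>s F. s \<in> G \<Longrightarrow> F \<in> M \<Longrightarrow> aM s ` F \<in> M"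
    and equivariant: "\<And>s v. s \<in> G \<Longrightarrow> aM s (g1 v) = g1 (a1 s v)" "\<And>s w. s \<in> G \<Longrightarrow> aM s (g2 w) = g2 (a2 s w)"
  shows "gmodule_isomorphic G (reduced_homology a1 K1 d ::
      ('f, 'x \<Rightarrow> 'x, ('v list \<Rightarrow> 'f) set) gmodule) (reduced_homology a2 K2 d)"
proof -
  have bij2: "bij (a2 s)" if "s \<in> G" for s
    using inverse(2)[OF that(1)] inverse(2)[OF Ginv(1)[OF that(1)]] Ginv(2)[OF that(1)]
    by (intro o_bij[of "a2 (inv s)"]) (auto simp: o_def)
  have bijM: "bij (aM s)" if "s \<in> G" for s
    using inverse(3)[OF that(1)] inverse(3)[OF Ginv(1)[OF that(1)]] Ginv(2)[OF that(1)]
    by (intro o_bij[of "aM (inv s)"]) (auto simp: o_def)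
  have bij1: "bij (a1 s)" if "s \<in> G" for s
    using inverse(1)[OF that(1)] inverse(1)[OF Ginv(1)[OF that(1)]] Ginv(2)[OF that(1)]
    by (intro o_bij[of "a1 (inv s)"]) (auto simp: o_def)
  \<comment> \<open>\<open>act_chain\<close> pulls faces back, so invariance is needed in this
    direction; it is invariance under \<open>inv s\<close>.\<close>
  have rinv: "F \<in> K1" if "s \<in> G" "a1 s ` F \<in> K1" for s F
    using inv(1)[OF Ginv(1)[OF that(1)] that(2)] inverse(1)[OF that(1)] by (simp add: image_image)
  have rinv2: "F \<in> K2" if "s \<in> G" "a2 s ` F \<in> K2" for s F
    using inv(2)[OF Ginv(1)[OF that(1)] that(2)] inverse(2)[OF that(1)] by (simp add: image_image)
  have rinvM: "F \<in> M" if "s \<in> G" "aM s ` F \<in> M" for s F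
    using inv(3)[OF Ginv(1)[OF that(1)] that(2)] inverse(3)[OF that(1)] by (simp add: image_image)
  have act1: "act_chain (a1 (inv s)) ` homology_class K1 d z = homology_class K1 d (act_chain (a1 (inv s)) z)"
    if "s \<in> G" for s and z :: "'v list \<Rightarrow> 'f"
    using inverse(1)[OF that] rinv[OF that] rinv[OF Ginv(1)[OF that]]
    by (intro act_homology_class[where h' = "a1 s"] bij1 that Ginv(1) fin)
  have act2: "act_chain (a2 (inv s)) ` homology_class K2 d z = homology_class K2 d (act_chain (a2 (inv s)) z)"
    if "s \<in> G" for s and z :: "'w list \<Rightarrow> 'f"
    using inverse(2)[OF that] rinv2[OF that] rinv2[OF Ginv(1)[OF that]]
    by (intro act_homology_class[where h' = "a2 s"] bij2 that Ginv(1) fin)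
  have hom_act: "homologous d (act_chain (a1 s) z) (act_chain (a2 s) w)"
    if s: "s \<in> G" and h: "homologous d z w" for s z w
  proof -
    from h obtain y where z: "z \<in> simplicial_cycles K1 d" and w: "w \<in> simplicial_cycles K2 d"
      and y: "y \<in> simplicial_chains M (d + 1)"
        "(\<lambda>xs. push_chain g1 z xs - push_chain g2 w xs) = simplicial_boundary y"
      unfolding homologous_def simplicial_boundaries_def by auto
    have "act_chain (a1 s) z \<in> simplicial_cycles K1 d"
      using act_chain_in_chains[OF bij_is_inj[OF bij1[OF s]] fin(1) cyclesD(1)[OF z] rinv[OF s]]
        boundary_act_chain[OF bij1[OF s], of z] cyclesD(2)[OF z]
      unfolding simplicial_cycles_def by simp
    moreover have "act_chain (a2 s) w \<in> simplicial_cycles K2 d"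
      using act_chain_in_chains[OF bij_is_inj[OF bij2[OF s]] fin(2) cyclesD(1)[OF w] rinv2[OF s]]
        boundary_act_chain[OF bij2[OF s], of w] cyclesD(2)[OF w]
      unfolding simplicial_cycles_def by simp
    moreover have "(\<lambda>xs. push_chain g1 (act_chain (a1 s) z) xs - push_chain g2 (act_chain (a2 s) w) xs)
        = simplicial_boundary (act_chain (aM s) y)"
      unfolding boundary_act_chain[OF bijM[OF s]] y(2)[symmetric]
        push_chain_act_chain[OF inj(1) equivariant(1)[OF s] bij_is_inj[OF bijM[OF s]] bij1[OF s]]
        push_chain_act_chain[OF inj(2) equivariant(2)[OF s] bij_is_inj[OF bijM[OF s]] bij2[OF s]]
      by (intro ext) (simp add: act_chain_def)
    moreover have "act_chain (aM s) y \<in> simplicial_chains M (d + 1)"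
      using act_chain_in_chains[OF bij_is_inj[OF bijM[OF s]] fin(3) y(1) rinvM[OF s]] .
    ultimately show ?thesis unfolding homologous_def simplicial_boundaries_def by auto
  qed
  \<comment> \<open>The choice is harmless: by \<open>homologous_class_eq_iff\<close> all candidates
    \<open>w\<close> lie in one class.\<close>
  define \<phi> where "\<phi> A = homology_class K2 d (SOME w. \<exists>z. homologous d z w \<and> A = homology_class K1 d z)" for A
  have \<phi>: "\<phi> (homology_class K1 d z) = homology_class K2 d w" if h: "homologous d z w" for z w
  proof -
    let ?Q = "\<lambda>w. \<exists>z'. homologous d z' w \<and> homology_class K1 d z = homology_class K1 d z'"
    from h have "\<exists>w. ?Q w" by blast
    then have "?Q (SOME w. ?Q w)" by (rule someI_ex)
    then obtain z' where z': "homologous d z' (SOME w. ?Q w)"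
      "homology_class K1 d z = homology_class K1 d z'" by blast
    show ?thesis unfolding \<phi>_def using homologous_class_eq_iff[OF h z'(1)] z'(2) by simp
  qed
  have bij\<phi>: "bij_betw \<phi> (homology_class K1 d ` simplicial_cycles K1 d)
      (homology_class K2 d ` simplicial_cycles K2 d)"
  proof (rule bij_betw_imageI[OF inj_onI])
    fix A B :: "('v list \<Rightarrow> 'f) set" assume "A \<in> homology_class K1 d ` simplicial_cycles K1 d"
      "B \<in> homology_class K1 d ` simplicial_cycles K1 d" and e: "\<phi> A = \<phi> B"
    then obtain z z' where z: "z \<in> simplicial_cycles K1 d" "A = homology_class K1 d z"
      and z': "z' \<in> simplicial_cycles K1 d" "B = homology_class K1 d z'" by blast
    from z(1) obtain w where w: "homologous d z w" by (rule homologous_total)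
    from z'(1) obtain w' where w': "homologous d z' w'" by (rule homologous_total)
    from e show "A = B" unfolding z z' \<phi>[OF w] \<phi>[OF w'] homologous_class_eq_iff[OF w w'] .
  next
    show "\<phi> ` homology_class K1 d ` simplicial_cycles K1 d = homology_class K2 d ` simplicial_cycles K2 d"
    proof (intro equalityI subsetI)
      fix B assume "B \<in> \<phi> ` homology_class K1 d ` simplicial_cycles K1 d"
      then obtain z where z: "z \<in> simplicial_cycles K1 d" "B = \<phi> (homology_class K1 d z)" by blast
      from z(1) obtain w where w: "homologous d z w" by (rule homologous_total)
      then show "B \<in> homology_class K2 d ` simplicial_cycles K2 d"
        unfolding z \<phi>[OF w] homologous_def by blast
    next
      fix B :: "('w list \<Rightarrow> 'f) set" assume "B \<in> homology_class K2 d ` simplicial_cycles K2 d"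
      then obtain w where w: "w \<in> simplicial_cycles K2 d" "B = homology_class K2 d w" by blast
      from w(1) obtain z where z: "homologous d z w" by (rule homologous_total')
      then have "z \<in> simplicial_cycles K1 d" unfolding homologous_def by blast
      then show "B \<in> \<phi> ` homology_class K1 d ` simplicial_cycles K1 d"
        unfolding w \<phi>[OF z, symmetric] by blast
    qed
  qed
  show ?thesis
    unfolding gmodule_isomorphic_def reduced_homology_simps
  proof (intro exI[of _ \<phi>] conjI ballI allI bij\<phi>)
    fix A B :: "('v list \<Rightarrow> 'f) set" assume "A \<in> homology_class K1 d ` simplicial_cycles K1 d"
      "B \<in> homology_class K1 d ` simplicial_cycles K1 d"
    then obtain z z' where z: "z \<in> simplicial_cycles K1 d" "A = homology_class K1 d z"
      and z': "z' \<in> simplicial_cycles K1 d" "B = homology_class K1 d z'" by blast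
    from z(1) obtain w where w: "homologous d z w" by (rule homologous_total)
    from z'(1) obtain w' where w': "homologous d z' w'" by (rule homologous_total)
    show "\<phi> {\<lambda>xs. x xs + y xs | x y. x \<in> A \<and> y \<in> B} = {\<lambda>xs. x xs + y xs | x y. x \<in> \<phi> A \<and> y \<in> \<phi> B}"
      unfolding z z' \<phi>[OF w] \<phi>[OF w'] homology_class_add by (rule \<phi>[OF homologous_add[OF w w']])
  next
    fix r and A :: "('v list \<Rightarrow> 'f) set" assume "A \<in> homology_class K1 d ` simplicial_cycles K1 d"
    then obtain z where z: "z \<in> simplicial_cycles K1 d" "A = homology_class K1 d z" by blast
    from z(1) obtain w where w: "homologous d z w" by (rule homologous_total)
    show "\<phi> {\<lambda>xs. r * x xs + b xs | x b. x \<in> A \<and> b \<in> simplicial_boundaries K1 d} =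
        {\<lambda>xs. r * x xs + b xs | x b. x \<in> \<phi> A \<and> b \<in> simplicial_boundaries K2 d}"
      unfolding z \<phi>[OF w] homology_class_scale by (rule \<phi>[OF homologous_scale[OF w]])
  next
    fix s and A :: "('v list \<Rightarrow> 'f) set" assume s: "s \<in> G" and "A \<in> homology_class K1 d ` simplicial_cycles K1 d"
    then obtain z where z: "z \<in> simplicial_cycles K1 d" "A = homology_class K1 d z" by blast
    from z(1) obtain w where w: "homologous d z w" by (rule homologous_total)
    show "\<phi> (act_chain (a1 (inv s)) ` A) = act_chain (a2 (inv s)) ` \<phi> A"
      unfolding z \<phi>[OF w] act1[OF s] act2[OF s] by (rule \<phi>[OF hom_act[OF Ginv(1)[OF s] w]])
  qed
qed

end

section \<open>The cylinder of a simplicial complex over a poset\<close>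

lemma Union_Inl_Inr_vimage: "\<rho> = Inl ` (Inl -` \<rho>) \<union> Inr ` (Inr -` \<rho>)"
proof (intro set_eqI)
  fix x show "x \<in> \<rho> \<longleftrightarrow> x \<in> Inl ` (Inl -` \<rho>) \<union> Inr ` (Inr -` \<rho>)"
    by (cases x) auto
qed

text \<open>Without antisymmetry, maximal means that whatever lies above \<open>p\<close> also lies
  below it. An element with inclusion-maximal down-set has this property.\<close>

lemma finite_has_preorder_maximal:
  assumes "finite P" "P \<noteq> {}" and refl: "\<And>p. p \<in> P \<Longrightarrow> le p p"
    and trans: "\<And>p q r. p \<in> P \<Longrightarrow> q \<in> P \<Longrightarrow> r \<in> P \<Longrightarrow> le p q \<Longrightarrow> le q r \<Longrightarrow> le p r"
  obtains p where "p \<in> P" "\<And>q. q \<in> P \<Longrightarrow> le p q \<Longrightarrow> le q p"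
proof -
  let ?D = "\<lambda>p. {q \<in> P. le q p}"
  have "finite (?D ` P)" "?D ` P \<noteq> {}" using assms(1,2) by auto
  from finite_has_maximal[OF this] obtain D where D: "D \<in> ?D ` P"
    "\<forall>E \<in> ?D ` P. D \<subseteq> E \<longrightarrow> D = E" by (rule bexE)
  from D(1) obtain p where p: "p \<in> P" "D = ?D p" by (rule imageE)
  show thesis
  proof (rule that[OF p(1)])
    fix q assume q: "q \<in> P" "le p q"
    have "?D p \<subseteq> ?D q"
    proof
      fix r assume "r \<in> ?D p"
      then have "r \<in> P" "le r p" by simp_all
      with q p(1) trans[of r p q] show "r \<in> ?D q" by simp
    qed
    then have "?D p = ?D q" using D(2) p(2) q(1) by simp
    then show "le q p" using refl q(1) by blast
  qed
qed

text \<open>Think of \<open>adm p \<sigma>\<close> as \<open>p \<le> f \<sigma>\<close> for an order-reversing \<open>f\<close> from the face poset of \<open>L\<close> to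
  \<open>P\<close> with a top added, which is the image of the empty face.\<close>

locale poset_cylinder =
  fixes le :: "'p \<Rightarrow> 'p \<Rightarrow> bool" and P :: "'p set" and adm :: "'p \<Rightarrow> 'v set \<Rightarrow> bool"
    and L :: "'v set set"
  assumes finP: "finite P" and finL: "finite (\<Union>L)"
    and downL: "\<sigma> \<in> L \<Longrightarrow> \<tau> \<subseteq> \<sigma> \<Longrightarrow> \<tau> \<in> L" and emptyL: "{} \<in> L"
    and refl: "p \<in> P \<Longrightarrow> le p p"
    and trans: "p \<in> P \<Longrightarrow> q \<in> P \<Longrightarrow> r \<in> P \<Longrightarrow> le p q \<Longrightarrow> le q r \<Longrightarrow> le p r"
    and adm_empty: "p \<in> P \<Longrightarrow> adm p {}"
    and adm_subset: "adm p \<sigma> \<Longrightarrow> \<tau> \<subseteq> \<sigma> \<Longrightarrow> adm p \<tau>"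
    and adm_le: "p \<in> P \<Longrightarrow> q \<in> P \<Longrightarrow> le p q \<Longrightarrow> adm q \<sigma> \<Longrightarrow> adm p \<sigma>"
    and poset_apex: "\<sigma> \<in> L \<Longrightarrow> \<sigma> \<noteq> {} \<Longrightarrow> \<exists>q\<in>P. adm q \<sigma> \<and> (\<forall>p\<in>P. adm p \<sigma> \<longrightarrow> le p q)"
    and fibre_apex: "p \<in> P \<Longrightarrow> \<exists>a. \<forall>\<sigma>\<in>L. adm p \<sigma> \<longrightarrow> insert a \<sigma> \<in> L \<and> adm p (insert a \<sigma>)"
begin

text \<open>Both parameters shrink during the deletions: \<open>Q\<close> down to the empty set,
  \<open>K\<close> down to the complex whose only face is empty.\<close>

definition cyl :: "'p set \<Rightarrow> 'v set set \<Rightarrow> ('p + 'v) set set" where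
  "cyl Q K = {\<rho>. Inl -` \<rho> \<in> order_complex le Q \<and> Inr -` \<rho> \<in> K \<and> (\<forall>p \<in> Inl -` \<rho>. adm p (Inr -` \<rho>))}"

lemma finite_cyl: "Q \<subseteq> P \<Longrightarrow> K \<subseteq> L \<Longrightarrow> finite (\<Union>(cyl Q K))"
proof (rule finite_subset)
  assume "Q \<subseteq> P" "K \<subseteq> L"
  show "\<Union>(cyl Q K) \<subseteq> Inl ` P \<union> Inr ` \<Union>L"
  proof
    fix x assume "x \<in> \<Union>(cyl Q K)"
    then obtain \<rho> where \<rho>: "x \<in> \<rho>" "Inl -` \<rho> \<subseteq> Q" "Inr -` \<rho> \<in> K"
      unfolding cyl_def order_complex_def by blast
    then show "x \<in> Inl ` P \<union> Inr ` \<Union>L"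
      using \<open>Q \<subseteq> P\<close> \<open>K \<subseteq> L\<close> by (cases x) blast+
  qed
  show "finite (Inl ` P \<union> Inr ` \<Union>L)" using finP finL by simp
qed

lemma order_complex_subset: "C \<in> order_complex le Q \<Longrightarrow> D \<subseteq> C \<Longrightarrow> D \<in> order_complex le Q"
  unfolding order_complex_def by (auto intro: finite_subset simp: Complete_Partial_Order.chain_def)

lemma cyl_down:
  assumes "\<And>\<sigma> \<tau>. \<sigma> \<in> K \<Longrightarrow> \<tau> \<subseteq> \<sigma> \<Longrightarrow> \<tau> \<in> K" "\<rho> \<in> cyl Q K" "\<pi> \<subseteq> \<rho>"
  shows "\<pi> \<in> cyl Q K"
proof -
  have "Inl -` \<pi> \<subseteq> Inl -` \<rho>" "Inr -` \<pi> \<subseteq> Inr -` \<rho>" using assms(3) by auto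
  moreover have "Inl -` \<rho> \<in> order_complex le Q" "Inr -` \<rho> \<in> K"
    "\<And>p. p \<in> Inl -` \<rho> \<Longrightarrow> adm p (Inr -` \<rho>)"
    using assms(2) unfolding cyl_def by simp_all
  ultimately have "Inl -` \<pi> \<in> order_complex le Q" "Inr -` \<pi> \<in> K"
    "\<And>p. p \<in> Inl -` \<pi> \<Longrightarrow> adm p (Inr -` \<pi>)"
    by (rule_tac [1] order_complex_subset, rule_tac [3] assms(1), rule_tac [5] adm_subset) auto
  then show ?thesis unfolding cyl_def by simp
qed

lemma cyl_mono: "Q \<subseteq> Q' \<Longrightarrow> K \<subseteq> K' \<Longrightarrow> cyl Q K \<subseteq> cyl Q' K'"
  unfolding cyl_def order_complex_def by blast

lemma cyl_empty_left: "cyl {} L = (`) Inr ` L"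
proof (intro equalityI subsetI)
  fix \<rho> assume "\<rho> \<in> cyl {} L"
  then have "Inl -` \<rho> = {}" "Inr -` \<rho> \<in> L" unfolding cyl_def order_complex_def by auto
  then have "\<rho> = Inr ` (Inr -` \<rho>)"
    using Union_Inl_Inr_vimage[of \<rho>] by (simp del: image_vimage_eq)
  with \<open>Inr -` \<rho> \<in> L\<close> show "\<rho> \<in> (`) Inr ` L" by (rule image_eqI[rotated])
next
  fix \<rho> :: "('p + 'v) set" assume "\<rho> \<in> (`) Inr ` L"
  then obtain \<sigma> where "\<sigma> \<in> L" "\<rho> = Inr ` \<sigma>" by blast
  moreover have "Inl -` (Inr ` \<sigma>) = ({} :: 'p set)" "Inr -` (Inr ` \<sigma> :: ('p + 'v) set) = \<sigma>" by auto
  ultimately show "\<rho> \<in> cyl {} L"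
    unfolding cyl_def order_complex_def Complete_Partial_Order.chain_def by simp
qed

text \<open>The end of the second deletion is \<open>{{}}\<close> and not \<open>{}\<close>: without
  the empty face in \<open>K\<close> the cylinder would have no faces at all.\<close>

lemma cyl_empty_right: "cyl P {{}} = (`) Inl ` order_complex le P"
proof (intro equalityI subsetI)
  fix \<rho> assume "\<rho> \<in> cyl P {{}}"
  then have "Inr -` \<rho> = {}" "Inl -` \<rho> \<in> order_complex le P" unfolding cyl_def by auto
  then have "\<rho> = Inl ` (Inl -` \<rho>)"
    using Union_Inl_Inr_vimage[of \<rho>] by (simp del: image_vimage_eq)
  with \<open>Inl -` \<rho> \<in> order_complex le P\<close> show "\<rho> \<in> (`) Inl ` order_complex le P"
    by (rule image_eqI[rotated])
next
  fix \<rho> :: "('p + 'v) set" assume "\<rho> \<in> (`) Inl ` order_complex le P"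
  then obtain C where C: "C \<in> order_complex le P" "\<rho> = Inl ` C" by blast
  moreover have "Inr -` (Inl ` C) = ({} :: 'v set)" "Inl -` (Inl ` C :: ('p + 'v) set) = C" by auto
  moreover have "C \<subseteq> P" using C(1) unfolding order_complex_def by blast
  ultimately show "\<rho> \<in> cyl P {{}}"
    unfolding cyl_def using adm_empty by auto
qed

text \<open>For \<open>p\<close> maximal in \<open>Q\<close>, comparability in a chain through
  \<open>p\<close> puts each of its elements below \<open>p\<close>. By \<open>adm_le\<close> they
  all admit what \<open>p\<close> admits, so the apex of the fibre of \<open>p\<close> can be added
  to every face of the star.\<close>

lemma rel_acyclic_right: "Q \<subseteq> P \<Longrightarrow> rel_acyclic TYPE('f::field) (cyl {} L) (cyl Q L)"
proof -
  assume "Q \<subseteq> P"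
  then have "finite Q" using finP finite_subset by blast
  then show ?thesis using \<open>Q \<subseteq> P\<close>
  proof (induction rule: finite_psubset_induct)
    case (psubset Q)
    show ?case
    proof (cases "Q = {}")
      case True
      then show ?thesis by (simp add: rel_acyclic_refl)
    next
      case False
      have "le q q" if "q \<in> Q" for q using that psubset.prems refl by blast
      moreover have "le q s" if "q \<in> Q" "r \<in> Q" "s \<in> Q" "le q r" "le r s" for q r s
        using that psubset.prems trans by blast
      ultimately obtain p where p: "p \<in> Q" "\<And>q. q \<in> Q \<Longrightarrow> le p q \<Longrightarrow> le q p"
        using finite_has_preorder_maximal[OF psubset.hyps False, of le] by blast
      then have pP: "p \<in> P" using psubset.prems by blast
      from fibre_apex[OF pP] obtain a where
        a: "\<And>\<sigma>. \<sigma> \<in> L \<Longrightarrow> adm p \<sigma> \<Longrightarrow> insert a \<sigma> \<in> L \<and> adm p (insert a \<sigma>)" by blast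
      have "{\<tau> \<in> cyl Q L. \<not> {Inl p} \<subseteq> \<tau>} = cyl (Q - {p}) L"
        unfolding cyl_def order_complex_def by auto
      moreover have "rel_acyclic TYPE('f) {\<tau> \<in> cyl Q L. \<not> {Inl p} \<subseteq> \<tau>} (cyl Q L)"
      proof (rule rel_acyclic_delete_star[where a = "Inr a"])
        show "finite (\<Union>(cyl Q L))" using finite_cyl psubset.prems by blast
        show "\<tau> \<in> cyl Q L" if "\<sigma> \<in> cyl Q L" "\<tau> \<subseteq> \<sigma>" for \<sigma> \<tau> using cyl_down[OF downL that] .
        fix \<tau> assume \<tau>: "\<tau> \<in> cyl Q L" "{Inl p} \<subseteq> \<tau>"
        then have ins: "insert a (Inr -` \<tau>) \<in> L" "adm p (insert a (Inr -` \<tau>))"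
          using a unfolding cyl_def by auto
        have "adm q (insert a (Inr -` \<tau>))" if q: "q \<in> Inl -` \<tau>" for q
        proof -
          have "q \<in> Q" "le p q \<or> le q p"
            using \<tau> q unfolding cyl_def order_complex_def Complete_Partial_Order.chain_def by auto
          then have "q \<in> P" "le q p" using p psubset.prems by auto
          then show ?thesis using adm_le pP ins(2) by blast
        qed
        moreover have "Inl -` insert (Inr a) \<tau> = Inl -` \<tau>" "Inr -` insert (Inr a) \<tau> = insert a (Inr -` \<tau>)"
          by auto
        ultimately show "insert (Inr a) \<tau> \<in> cyl Q L" using \<tau>(1) ins(1) unfolding cyl_def by simp
      qed simp
      ultimately have step: "rel_acyclic TYPE('f) (cyl (Q - {p}) L) (cyl Q L)" by simp
      have IH: "rel_acyclic TYPE('f) (cyl {} L) (cyl (Q - {p}) L)"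
        using psubset.IH[of "Q - {p}"] p(1) psubset.prems by blast
      have fin: "finite (\<Union>(cyl Q L))" using finite_cyl psubset.prems by blast
      show ?thesis
        by (rule rel_acyclic_trans[OF IH step _ _ fin cyl_down[OF downL]])
          (use cyl_mono[of "{}" "Q - {p}" L L] cyl_mono[of "Q - {p}" Q L L] in auto)
    qed
  qed
qed

text \<open>For \<sigma> maximal in \<open>K\<close>, the faces containing \<sigma> have exactly
  \<sigma> as their part in \<open>K\<close>. Their chains consist of elements admitting \<sigma>,
  and the greatest such element extends each of these chains. The induction runs through
  subcomplexes that keep the empty face.\<close>

lemma rel_acyclic_left_aux:
  assumes "finite K" "K \<subseteq> L" "{} \<in> K" "\<And>\<sigma> \<tau>. \<sigma> \<in> K \<Longrightarrow> \<tau> \<subseteq> \<sigma> \<Longrightarrow> \<tau> \<in> K"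
  shows "rel_acyclic TYPE('f::field) (cyl P {{}}) (cyl P K)"
  using assms
proof (induction rule: finite_psubset_induct)
  case (psubset K)
  show ?case
  proof (cases "K = {{}}")
    case True
    then show ?thesis by (simp add: rel_acyclic_refl)
  next
    case False
    obtain \<sigma> where \<sigma>: "\<sigma> \<in> K" "\<And>\<tau>. \<tau> \<in> K \<Longrightarrow> \<sigma> \<subseteq> \<tau> \<Longrightarrow> \<sigma> = \<tau>"
      using finite_has_maximal[OF psubset.hyps] psubset.prems(2) by blast
    have ne: "\<sigma> \<noteq> {}"
    proof
      assume "\<sigma> = {}"
      with \<sigma>(2) have "K \<subseteq> {{}}" by auto
      with False psubset.prems(2) show False by auto
    qed
    from \<sigma>(1) psubset.prems(1) poset_apex[OF _ ne] obtain q where q: "q \<in> P" "adm q \<sigma>"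
      "\<And>p. p \<in> P \<Longrightarrow> adm p \<sigma> \<Longrightarrow> le p q" by blast
    have star: "Inr ` \<sigma> \<subseteq> \<tau> \<longleftrightarrow> Inr -` \<tau> = \<sigma>" if "Inr -` \<tau> \<in> K" for \<tau> :: "('p + 'v) set"
      using \<sigma>(2)[OF that] by (auto simp: image_subset_iff_subset_vimage)
    have "{\<tau> \<in> cyl P K. \<not> Inr ` \<sigma> \<subseteq> \<tau>} = cyl P (K - {\<sigma>})"
      unfolding cyl_def by (intro Collect_cong) (use star in auto)
    moreover have fin: "finite (\<Union>(cyl P K))" using finite_cyl psubset.prems(1) by blast
    have "rel_acyclic TYPE('f) {\<tau> \<in> cyl P K. \<not> Inr ` \<sigma> \<subseteq> \<tau>} (cyl P K)"
    proof (rule rel_acyclic_delete_star[where a = "Inl q", OF fin])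
      show "\<tau> \<in> cyl P K" if "\<sigma> \<in> cyl P K" "\<tau> \<subseteq> \<sigma>" for \<sigma> \<tau> using cyl_down[OF psubset.prems(3) that] .
      fix \<tau> assume \<tau>: "\<tau> \<in> cyl P K" "Inr ` \<sigma> \<subseteq> \<tau>"
      then have "Inr -` \<tau> \<in> K" unfolding cyl_def by simp
      then have \<tau>\<sigma>: "Inr -` \<tau> = \<sigma>" using iffD1[OF star \<tau>(2)] by simp
      have "le p q" if "p \<in> Inl -` \<tau>" for p
      proof (rule q(3))
        have "Inl -` \<tau> \<in> order_complex le P" "\<forall>p \<in> Inl -` \<tau>. adm p (Inr -` \<tau>)"
          using \<tau>(1) unfolding cyl_def by simp_all
        then show "p \<in> P" "adm p \<sigma>" using that unfolding order_complex_def \<tau>\<sigma> by auto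
      qed
      moreover have "Inl -` \<tau> \<in> order_complex le P" using \<tau>(1) unfolding cyl_def by simp
      ultimately have "insert q (Inl -` \<tau>) \<in> order_complex le P"
        using q(1) refl[OF q(1)]
        unfolding order_complex_def Complete_Partial_Order.chain_def by simp
      moreover have "Inl -` insert (Inl q) \<tau> = insert q (Inl -` \<tau>)" "Inr -` insert (Inl q) \<tau> = Inr -` \<tau>"
        by auto
      ultimately show "insert (Inl q) \<tau> \<in> cyl P K" using \<tau>(1) q(2) \<tau>\<sigma> unfolding cyl_def by simp
    qed auto
    ultimately have step: "rel_acyclic TYPE('f) (cyl P (K - {\<sigma>})) (cyl P K)" by simp
    have IH: "rel_acyclic TYPE('f) (cyl P {{}}) (cyl P (K - {\<sigma>}))"
    proof (rule psubset.IH)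
      \<comment> \<open>Removing a maximal face leaves a complex: only a face containing \<sigma>
        could have \<sigma> as a subset.\<close>
      show "\<tau> \<in> K - {\<sigma>}" if "\<rho> \<in> K - {\<sigma>}" "\<tau> \<subseteq> \<rho>" for \<rho> \<tau>
        using that \<sigma>(2)[of \<rho>] psubset.prems(3)[of \<rho> \<tau>] by blast
    qed (use \<sigma>(1) ne psubset.prems in auto)
    show ?thesis
      by (rule rel_acyclic_trans[OF IH step _ _ fin cyl_down[OF psubset.prems(3)]])
        (use cyl_mono[of P P "{{}}" "K - {\<sigma>}"] cyl_mono[of P P "K - {\<sigma>}" K] ne psubset.prems(2)
          in auto)
  qed
qed

lemma rel_acyclic_left: "rel_acyclic TYPE('f::field) (cyl P {{}}) (cyl P L)"
  using finite_UnionD[OF finL] emptyL downL by (intro rel_acyclic_left_aux) auto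

text \<open>The group acts on the cylinder vertex by vertex through \<open>map_sum\<close>; chains,
  faces of \<open>L\<close> and admissibility are each preserved, so cylinder faces are too.\<close>

lemma homology_iso:
  assumes Ginv: "\<And>s. s \<in> G \<Longrightarrow> inv s \<in> G" "\<And>s. s \<in> G \<Longrightarrow> inv (inv s) = s"
    and inverse: "\<And>s v. s \<in> G \<Longrightarrow> a1 (inv s) (a1 s v) = v" "\<And>s v. s \<in> G \<Longrightarrow> a2 (inv s) (a2 s v) = v"
    and invP: "\<And>s p. s \<in> G \<Longrightarrow> p \<in> P \<Longrightarrow> a1 s p \<in> P"
    and inv_le: "\<And>s p q. s \<in> G \<Longrightarrow> le p q \<Longrightarrow> le (a1 s p) (a1 s q)"
    and invL: "\<And>s F. s \<in> G \<Longrightarrow> F \<in> L \<Longrightarrow> a2 s ` F \<in> L"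
    and inv_adm: "\<And>s p F. s \<in> G \<Longrightarrow> adm p F \<Longrightarrow> adm (a1 s p) (a2 s ` F)"
  shows "gmodule_isomorphic G
     (reduced_homology a1 (order_complex le P) d :: ('f::field, 'x \<Rightarrow> 'x, ('p list \<Rightarrow> 'f) set) gmodule)
     (reduced_homology a2 L d)"
proof -
  have order_complex_inv: "a1 s ` C \<in> order_complex le P" if "s \<in> G" "C \<in> order_complex le P" for s C
    using that invP inv_le unfolding order_complex_def Complete_Partial_Order.chain_def by blast
  interpret common_complex "order_complex le P" L "cyl P L" Inl Inr "TYPE('f)"
  proof
    have "\<Union>(order_complex le P) \<subseteq> P" unfolding order_complex_def by blast
    then show "finite (\<Union>(order_complex le P))" using finP finite_subset by blast
    show "finite (\<Union>(cyl P L))" by (simp add: finite_cyl)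
    show "\<And>\<rho> \<pi>. \<rho> \<in> cyl P L \<Longrightarrow> \<pi> \<subseteq> \<rho> \<Longrightarrow> \<pi> \<in> cyl P L" using cyl_down[OF downL] .
    show "(`) Inl ` order_complex le P \<subseteq> cyl P L"
      unfolding cyl_empty_right[symmetric] using emptyL by (intro cyl_mono) auto
    show "(`) Inr ` L \<subseteq> cyl P L"
      unfolding cyl_empty_left[symmetric] by (intro cyl_mono) auto
    show "rel_acyclic TYPE('f) ((`) Inl ` order_complex le P) (cyl P L)"
      unfolding cyl_empty_right[symmetric] by (rule rel_acyclic_left)
    show "rel_acyclic TYPE('f) ((`) Inr ` L) (cyl P L)"
      unfolding cyl_empty_left[symmetric] by (rule rel_acyclic_right) simp
  qed (use finL downL order_complex_subset in auto)
  show ?thesis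
  proof (rule gmodule_isomorphic_homology[where aM = "\<lambda>s. map_sum (a1 s) (a2 s)"])
    fix s and v :: "'p + 'v" assume s: "s \<in> G"
    show "map_sum (a1 (inv s)) (a2 (inv s)) (map_sum (a1 s) (a2 s) v) = v"
      using inverse[OF s] by (cases v) auto
  next
    fix s F assume s: "s \<in> G" and F: "F \<in> cyl P L"
    have "map_sum (a1 s) (a2 s) ` F = Inl ` a1 s ` (Inl -` F) \<union> Inr ` a2 s ` (Inr -` F)"
      by (subst Union_Inl_Inr_vimage[of F]) (simp add: image_Un image_image del: image_vimage_eq)
    moreover have "Inl -` (Inl ` A \<union> Inr ` B) = A" "Inr -` (Inl ` A \<union> Inr ` B) = B"
      for A :: "'p set" and B :: "'v set" by auto
    ultimately have "Inl -` (map_sum (a1 s) (a2 s) ` F) = a1 s ` (Inl -` F)"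
      "Inr -` (map_sum (a1 s) (a2 s) ` F) = a2 s ` (Inr -` F)" by simp_all
    then show "map_sum (a1 s) (a2 s) ` F \<in> cyl P L"
      using F order_complex_inv[OF s] invL[OF s] inv_adm[OF s] unfolding cyl_def by simp
  qed (use Ginv inverse order_complex_inv invL in auto)
qed

end

section \<open>Ordered set partitions as chains of subsets\<close>

text \<open>An ordered set partition without its last block, which is the complement of the others
  and the only block that may be empty. \<open>sorted_wrt\<close> expresses disjointness by position
  and splits well along appended lists.\<close>

definition block_list :: "nat \<Rightarrow> nat set list \<Rightarrow> bool" where
  "block_list n Bs \<longleftrightarrow> {} \<notin> set Bs \<and> sorted_wrt (\<lambda>A B. A \<inter> B = {}) Bs \<and> \<Union>(set Bs) \<subseteq> {1..n}"

definition close_list :: "nat \<Rightarrow> nat set list \<Rightarrow> nat set list" where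
  "close_list n Bs = Bs @ [{1..n} - \<Union>(set Bs)]"

definition cut_vertex :: "nat \<Rightarrow> nat set \<Rightarrow> nat set list" where
  "cut_vertex n A = [A, {1..n} - A]"

text \<open>The full set \<open>{1..n}\<close> is allowed because the last block may be empty; the
  empty set is excluded because the first block of a vertex may not be.\<close>

definition set_chain :: "nat \<Rightarrow> nat set set \<Rightarrow> bool" where
  "set_chain n \<A> \<longleftrightarrow> (\<forall>A\<in>\<A>. A \<noteq> {} \<and> A \<subseteq> {1..n}) \<and> (\<forall>A\<in>\<A>. \<forall>B\<in>\<A>. A \<subseteq> B \<or> B \<subseteq> A)"

lemma pairwise_disjoint_iff_sorted_wrt:
  "(\<forall>i < length Cs. \<forall>j < length Cs. i \<noteq> j \<longrightarrow> Cs ! i \<inter> Cs ! j = {}) \<longleftrightarrow>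
   sorted_wrt (\<lambda>A B. A \<inter> B = {}) Cs"
  unfolding sorted_wrt_iff_nth_less
proof (intro iffI allI impI)
  fix i j
  assume *: "\<forall>i j. i < j \<longrightarrow> j < length Cs \<longrightarrow> Cs ! i \<inter> Cs ! j = {}"
    and "i < length Cs" "j < length Cs" "i \<noteq> j"
  then have "Cs ! i \<inter> Cs ! j = {} \<or> Cs ! j \<inter> Cs ! i = {}"
    using linorder_neqE_nat[of i j] by blast
  then show "Cs ! i \<inter> Cs ! j = {}" by blast
qed auto

lemma ordered_set_partitions_eq: "ordered_set_partitions n = close_list n ` Collect (block_list n)"
proof (intro equalityI subsetI)
  fix Cs assume Cs: "Cs \<in> ordered_set_partitions n"
  then obtain Bs Z where BZ: "Cs = Bs @ [Z]" unfolding ordered_set_partitions_def by (cases Cs rule: rev_cases) auto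
  have *: "{} \<notin> set Bs" "sorted_wrt (\<lambda>A B. A \<inter> B = {}) (Bs @ [Z])" "\<Union>(set (Bs @ [Z])) = {1..n}"
    using Cs unfolding ordered_set_partitions_def pairwise_disjoint_iff_sorted_wrt BZ by auto
  then have "Z = {1..n} - \<Union>(set Bs)" by (auto simp: sorted_wrt_append)
  moreover have "block_list n Bs" using * unfolding block_list_def sorted_wrt_append by auto
  ultimately show "Cs \<in> close_list n ` Collect (block_list n)" unfolding BZ close_list_def by auto
next
  fix Cs assume "Cs \<in> close_list n ` Collect (block_list n)"
  then obtain Bs where Bs: "{} \<notin> set Bs" "sorted_wrt (\<lambda>A B. A \<inter> B = {}) Bs" "\<Union>(set Bs) \<subseteq> {1..n}"
    and Cs: "Cs = Bs @ [{1..n} - \<Union>(set Bs)]"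
    unfolding block_list_def close_list_def by blast
  have "\<Union>(set Cs) = {1..n}" using Bs(3) unfolding Cs by auto
  moreover have "sorted_wrt (\<lambda>A B. A \<inter> B = {}) Cs" using Bs(2) unfolding Cs sorted_wrt_append by auto
  ultimately show "Cs \<in> ordered_set_partitions n"
    using Bs(1) unfolding ordered_set_partitions_def pairwise_disjoint_iff_sorted_wrt
    by (auto simp: Cs)
qed

lemma block_list_take_drop:
  assumes "block_list n Bs"
  shows "\<Union>(set (take i Bs)) \<inter> \<Union>(set (drop i Bs)) = {}"
proof -
  have "sorted_wrt (\<lambda>A B. A \<inter> B = {}) (take i Bs @ drop i Bs)"
    using assms unfolding block_list_def by simp
  then show ?thesis unfolding sorted_wrt_append by blast
qed

text \<open>A cut after i blocks has the i-th partial union as first part and its complement as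
  second. The closing block adds one to the length, so the last admissible cut is the one just
  before it.\<close>

lemma osp_simplex_close_list:
  assumes "block_list n Bs"
  shows "osp_simplex (close_list n Bs) = cut_vertex n ` (\<lambda>i. \<Union>(set (take i Bs))) ` {1..length Bs}"
proof -
  have "cut (close_list n Bs) i = cut_vertex n (\<Union>(set (take i Bs)))" if "i \<le> length Bs" for i
  proof -
    have "set Bs = set (take i Bs) \<union> set (drop i Bs)" by (metis append_take_drop_id set_append)
    moreover have "\<Union>(set Bs) \<subseteq> {1..n}" using assms unfolding block_list_def by blast
    ultimately show ?thesis
      using that block_list_take_drop[OF assms, of i] unfolding close_list_def cut_vertex_def by auto
  qed
  moreover have "{1..<length (close_list n Bs)} = {1..length Bs}" unfolding close_list_def by auto
  ultimately show ?thesis unfolding osp_simplex_cuts image_image by (intro image_cong) auto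
qed

lemma block_list_snoc:
  assumes "block_list n Bs" "A \<subseteq> {1..n}" "\<Union>(set Bs) \<subset> A"
  shows "block_list n (Bs @ [A - \<Union>(set Bs)])"
    and "osp_simplex (close_list n (Bs @ [A - \<Union>(set Bs)])) =
      insert (cut_vertex n A) (osp_simplex (close_list n Bs))"
proof -
  show b: "block_list n (Bs @ [A - \<Union>(set Bs)])"
    using assms unfolding block_list_def by (auto simp: sorted_wrt_append)
  let ?f = "\<lambda>i. \<Union>(set (take i (Bs @ [A - \<Union>(set Bs)])))"
  have "{1..length (Bs @ [A - \<Union>(set Bs)])} = insert (Suc (length Bs)) {1..length Bs}" by auto
  moreover have "?f (Suc (length Bs)) = A"
  proof -
    have "?f (Suc (length Bs)) = \<Union>(set Bs) \<union> (A - \<Union>(set Bs))" by auto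
    then show ?thesis using assms(3) by blast
  qed
  moreover have "?f ` {1..length Bs} = (\<lambda>i. \<Union>(set (take i Bs))) ` {1..length Bs}"
    by (intro image_cong) auto
  ultimately show "osp_simplex (close_list n (Bs @ [A - \<Union>(set Bs)])) =
      insert (cut_vertex n A) (osp_simplex (close_list n Bs))"
    unfolding osp_simplex_close_list[OF b] osp_simplex_close_list[OF assms(1)]
    by (simp only: image_insert)
qed

lemma set_chain_subset: "set_chain n \<A> \<Longrightarrow> \<B> \<subseteq> \<A> \<Longrightarrow> set_chain n \<B>"
  unfolding set_chain_def by blast

lemma set_chain_finite: "set_chain n \<A> \<Longrightarrow> finite \<A>"
  by (rule finite_subset[of _ "Pow {1..n}"]) (auto simp: set_chain_def)

text \<open>The blocks are the successive differences of the chain, obtained by splitting off its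
  largest member. The clause on the union of \<open>Bs\<close> strengthens the induction: it makes
  the next difference nonempty.\<close>

lemma set_chain_block_list:
  assumes "set_chain n \<A>"
  shows "\<exists>Bs. block_list n Bs \<and> \<Union>(set Bs) \<in> insert {} \<A> \<and>
    osp_simplex (close_list n Bs) = cut_vertex n ` \<A>"
  using set_chain_finite[OF assms] assms
proof (induction rule: finite_psubset_induct)
  case (psubset \<A>)
  show ?case
  proof (cases "\<A> = {}")
    case True
    have "block_list n []" unfolding block_list_def by simp
    then show ?thesis using True osp_simplex_close_list[of n "[]"] by (intro exI[of _ "[]"]) simp
  next
    case False
    obtain A where A: "A \<in> \<A>" "\<And>B. B \<in> \<A> \<Longrightarrow> A \<subseteq> B \<Longrightarrow> A = B"
      using finite_has_maximal[OF psubset.hyps False] by blast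
    have max: "B \<subseteq> A" if "B \<in> \<A>" for B
      using A(1) A(2)[OF that] that psubset.prems unfolding set_chain_def by blast
    have An: "A \<noteq> {}" "A \<subseteq> {1..n}" using psubset.prems A(1) unfolding set_chain_def by auto
    from psubset.IH[of "\<A> - {A}"] A(1) set_chain_subset[OF psubset.prems, of "\<A> - {A}"]
    obtain Bs where Bs: "block_list n Bs" "\<Union>(set Bs) \<in> insert {} (\<A> - {A})"
      "osp_simplex (close_list n Bs) = cut_vertex n ` (\<A> - {A})" by blast
    have sub: "\<Union>(set Bs) \<subset> A" using Bs(2) max An(1) by blast
    show ?thesis
    proof (intro exI[of _ "Bs @ [A - \<Union>(set Bs)]"] conjI)
      show "block_list n (Bs @ [A - \<Union>(set Bs)])" using block_list_snoc(1)[OF Bs(1) An(2) sub] .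
      have "\<Union>(set (Bs @ [A - \<Union>(set Bs)])) = A" using sub by auto
      then show "\<Union>(set (Bs @ [A - \<Union>(set Bs)])) \<in> insert {} \<A>" using A(1) by simp
      show "osp_simplex (close_list n (Bs @ [A - \<Union>(set Bs)])) = cut_vertex n ` \<A>"
        unfolding block_list_snoc(2)[OF Bs(1) An(2) sub] Bs(3) using A(1) by blast
    qed
  qed
qed

lemma block_list_set_chain:
  assumes "block_list n Bs"
  shows "set_chain n ((\<lambda>i. \<Union>(set (take i Bs))) ` {1..length Bs})"
  unfolding set_chain_def
proof (intro conjI ballI)
  fix A assume "A \<in> (\<lambda>i. \<Union>(set (take i Bs))) ` {1..length Bs}"
  then obtain i where i: "1 \<le> i" "i \<le> length Bs" "A = \<Union>(set (take i Bs))" by auto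
  show "A \<subseteq> {1..n}"
    using assms unfolding block_list_def i(3) by (meson Union_mono order_trans set_take_subset)
  have "Bs ! 0 \<in> set (take i Bs)" using i by (auto simp: in_set_conv_nth intro!: exI[of _ 0])
  moreover from this have "Bs ! 0 \<noteq> {}" using assms in_set_takeD unfolding block_list_def by metis
  ultimately show "A \<noteq> {}" unfolding i(3) by blast
next
  fix A B assume "A \<in> (\<lambda>i. \<Union>(set (take i Bs))) ` {1..length Bs}"
    "B \<in> (\<lambda>i. \<Union>(set (take i Bs))) ` {1..length Bs}"
  then obtain i j where "A = \<Union>(set (take i Bs))" "B = \<Union>(set (take j Bs))" by blast
  then show "A \<subseteq> B \<or> B \<subseteq> A"
    using set_take_subset_set_take[of i j Bs] set_take_subset_set_take[of j i Bs] by (meson Union_mono linear)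
qed

text \<open>Hence this complex is the order complex of the nonempty subsets of
  \<open>{1..n}\<close>, the barycentric subdivision of a simplex. In this form subfaces and added
  vertices are subsets and insertions, with no merging of lists.\<close>

lemma Delta_complex_iff: "\<sigma> \<in> Delta_complex n \<longleftrightarrow> (\<exists>\<A>. set_chain n \<A> \<and> \<sigma> = cut_vertex n ` \<A>)"
proof
  assume "\<sigma> \<in> Delta_complex n"
  then obtain Bs where Bs: "block_list n Bs" "\<sigma> = osp_simplex (close_list n Bs)"
    unfolding Delta_complex_def ordered_set_partitions_eq by blast
  show "\<exists>\<A>. set_chain n \<A> \<and> \<sigma> = cut_vertex n ` \<A>"
    using block_list_set_chain[OF Bs(1)] osp_simplex_close_list[OF Bs(1)] Bs(2) by blast
next
  assume "\<exists>\<A>. set_chain n \<A> \<and> \<sigma> = cut_vertex n ` \<A>"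
  then obtain \<A> where \<A>: "set_chain n \<A>" "\<sigma> = cut_vertex n ` \<A>" by blast
  from set_chain_block_list[OF \<A>(1)] obtain Bs where
    "block_list n Bs" "osp_simplex (close_list n Bs) = cut_vertex n ` \<A>" by blast
  then show "\<sigma> \<in> Delta_complex n"
    unfolding Delta_complex_def ordered_set_partitions_eq \<A>(2) image_image
    by (intro image_eqI[of _ _ Bs]) simp_all
qed

section \<open>Saturated cuts\<close>

fun saturated :: "pointed_part \<Rightarrow> nat set \<Rightarrow> bool" where
  "saturated (P, Z) A \<longleftrightarrow> A \<inter> Z = {} \<and> (\<forall>B\<in>P. B \<subseteq> A \<or> B \<inter> A = {})"

text \<open>The first block of a vertex suffices, the second being its complement. The condition
  \<open>V \<noteq> []\<close> lets \<open>hd\<close> commute with relabeling.\<close>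

definition saturated_face :: "pointed_part \<Rightarrow> nat set list set \<Rightarrow> bool" where
  "saturated_face p \<sigma> \<longleftrightarrow> (\<forall>V\<in>\<sigma>. V \<noteq> [] \<and> saturated p (hd V))"

lemma saturated_face_cut_vertex: "saturated_face p (cut_vertex n ` \<A>) \<longleftrightarrow> (\<forall>A\<in>\<A>. saturated p A)"
  unfolding saturated_face_def cut_vertex_def by simp

lemma pointed_le_refl: "pointed_le p p"
  by (cases p) auto

lemma pointed_le_trans: "pointed_le p q \<Longrightarrow> pointed_le q r \<Longrightarrow> pointed_le p r"
proof (cases p; cases q; cases r)
  fix P Z P' Z' P'' Z''
  assume pqr: "p = (P, Z)" "q = (P', Z')" "r = (P'', Z'')" and le: "pointed_le p q" "pointed_le q r"
  have "\<exists>C\<in>insert Z'' P''. B \<subseteq> C" if "B \<in> P" for B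
  proof -
    from le(1) that obtain C where C: "C \<in> insert Z' P'" "B \<subseteq> C" unfolding pqr pointed_le.simps by blast
    moreover have "\<exists>D\<in>insert Z'' P''. C \<subseteq> D" using le(2) C(1) unfolding pqr by auto
    ultimately show ?thesis by (meson order_trans)
  qed
  then show "pointed_le p r" using le unfolding pqr by auto
qed

text \<open>Every block of \<open>q\<close>, the pointed one included, lies inside \<open>A\<close>
  or misses it, and the blocks of \<open>p\<close> inside it inherit this.\<close>

lemma saturated_le: "pointed_le p q \<Longrightarrow> saturated q A \<Longrightarrow> saturated p A"
proof (cases p; cases q)
  fix P Z P' Z'
  assume pq: "p = (P, Z)" "q = (P', Z')" and le: "pointed_le p q" and sat: "saturated q A"
  have "B \<subseteq> A \<or> B \<inter> A = {}" if "B \<in> P" for B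
  proof -
    from le that obtain C where C: "C \<in> insert Z' P'" "B \<subseteq> C" unfolding pq pointed_le.simps by blast
    from C(1) sat have "C \<subseteq> A \<or> C \<inter> A = {}" unfolding pq by auto
    with C(2) show ?thesis by blast
  qed
  then show "saturated p A" using le sat unfolding pq by auto
qed

lemma forget_order_close_list: "forget_order (close_list n Bs) = (set Bs, {1..n} - \<Union>(set Bs))"
  unfolding close_list_def by simp

lemma forget_order_in_pointed_partitions:
  assumes "block_list n Bs"
  shows "forget_order (close_list n Bs) \<in> pointed_partitions n"
proof -
  have "{1..n} - ({1..n} - \<Union>(set Bs)) = \<Union>(set Bs)"
    using assms unfolding block_list_def by blast
  moreover have "A \<inter> B = {}" if AB: "A \<in> set Bs" "B \<in> set Bs" "A \<noteq> B" for A B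
  proof -
    from AB(1,2) obtain i j where "i < length Bs" "A = Bs ! i" "j < length Bs" "B = Bs ! j"
      unfolding in_set_conv_nth by blast
    moreover have "\<forall>i < length Bs. \<forall>j < length Bs. i \<noteq> j \<longrightarrow> Bs ! i \<inter> Bs ! j = {}"
      using assms unfolding block_list_def pairwise_disjoint_iff_sorted_wrt by blast
    ultimately show ?thesis using AB(3) by blast
  qed
  then have "partition_on (\<Union>(set Bs)) (set Bs)"
    using assms unfolding block_list_def by (intro partition_onI) (auto simp: disjnt_def)
  ultimately show ?thesis
    unfolding forget_order_close_list pointed_partitions_def by simp
qed

text \<open>A block of \<open>p\<close> inside a single block of the list lies on one side of every
  cut. Conversely, a saturated block is swallowed whole by the first partial union that it meets,
  hence by the block added there; if it meets none, it lies in the closing block.\<close>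

lemma pointed_le_forget_order_iff:
  assumes p: "p \<in> pointed_partitions n" and Bs: "block_list n Bs"
  shows "pointed_le p (forget_order (close_list n Bs)) \<longleftrightarrow> saturated_face p (osp_simplex (close_list n Bs))"
proof -
  obtain P Z where PZ: "p = (P, Z)" by (cases p)
  have Z: "Z \<subseteq> {1..n}" and P: "partition_on ({1..n} - Z) P" using p unfolding PZ pointed_partitions_def by auto
  have face: "saturated_face p (osp_simplex (close_list n Bs)) \<longleftrightarrow>
      (\<forall>i\<in>{1..length Bs}. saturated (P, Z) (\<Union>(set (take i Bs))))"
    unfolding osp_simplex_close_list[OF Bs] saturated_face_cut_vertex PZ by simp
  show ?thesis unfolding face
  proof
    assume "pointed_le p (forget_order (close_list n Bs))"
    then have le: "\<And>B. B \<in> P \<Longrightarrow> B \<subseteq> {1..n} - \<Union>(set Bs) \<or> (\<exists>C\<in>set Bs. B \<subseteq> C)"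
      "Z \<subseteq> {1..n} - \<Union>(set Bs)" unfolding PZ forget_order_close_list by auto
    show "\<forall>i\<in>{1..length Bs}. saturated (P, Z) (\<Union>(set (take i Bs)))"
    proof
      fix i
      have sub: "\<Union>(set (take i Bs)) \<subseteq> \<Union>(set Bs)" by (intro Union_mono set_take_subset)
      have "B \<subseteq> \<Union>(set (take i Bs)) \<or> B \<inter> \<Union>(set (take i Bs)) = {}" if "B \<in> P" for B
      proof -
        from le(1)[OF that] consider "B \<subseteq> {1..n} - \<Union>(set Bs)" | C where "C \<in> set Bs" "B \<subseteq> C" by blast
        then show ?thesis
        proof cases
          case 1
          then show ?thesis using sub by blast
        next
          case 2
          have "set Bs = set (take i Bs) \<union> set (drop i Bs)" by (metis append_take_drop_id set_append)
          then show ?thesis using 2 block_list_take_drop[OF Bs, of i] by blast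
        qed
      qed
      moreover have "\<Union>(set (take i Bs)) \<inter> Z = {}" using le(2) sub by blast
      ultimately show "saturated (P, Z) (\<Union>(set (take i Bs)))" by simp
    qed
  next
    assume sat: "\<forall>i\<in>{1..length Bs}. saturated (P, Z) (\<Union>(set (take i Bs)))"
    have "Z \<subseteq> {1..n} - \<Union>(set Bs)"
    \<comment> \<open>An empty list has no cut to consult, but then the closing block is all of
      \<open>{1..n}\<close>.\<close>
    proof (cases "Bs = []")
      case False
      then have "saturated (P, Z) (\<Union>(set (take (length Bs) Bs)))"
        using sat by (intro sat[rule_format]) (simp add: Suc_le_eq)
      then show ?thesis using Z by auto
    qed (use Z in simp)
    moreover have "\<exists>C\<in>insert ({1..n} - \<Union>(set Bs)) (set Bs). B \<subseteq> C" if B: "B \<in> P" for B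
    proof (cases "B \<inter> \<Union>(set Bs) = {}")
      case True
      have "B \<subseteq> {1..n}" using P B unfolding partition_on_def by blast
      with True show ?thesis by blast
    next
      case False
      let ?Q = "\<lambda>i. B \<inter> \<Union>(set (take i Bs)) \<noteq> {}"
      \<comment> \<open>The first partial union meeting \<open>B\<close>. It is not the zeroth,
        which is empty, so \<open>B\<close> misses its predecessor and lies in the block
        \<open>Bs ! j\<close> between the two.\<close>
      define i where "i = (LEAST i. ?Q i)"
      have Q: "?Q (length Bs)" using False by simp
      have i: "?Q i" "i \<le> length Bs" unfolding i_def using LeastI[of ?Q, OF Q] Least_le[of ?Q, OF Q] by auto
      then obtain j where j: "i = Suc j" by (cases i) auto
      then have nj: "\<not> ?Q j" using not_less_Least[of j ?Q] i_def by simp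
      have "saturated (P, Z) (\<Union>(set (take i Bs)))" using sat i(2) j by auto
      then have "B \<subseteq> \<Union>(set (take (Suc j) Bs))" using B i(1) unfolding j by auto
      moreover have "take (Suc j) Bs = take j Bs @ [Bs ! j]"
        using i(2) j by (intro take_Suc_conv_app_nth) simp
      ultimately have "B \<subseteq> Bs ! j" using nj by auto
      moreover have "Bs ! j \<in> set Bs" using i(2) j by simp
      ultimately show ?thesis by blast
    qed
    ultimately show "pointed_le p (forget_order (close_list n Bs))"
      unfolding PZ forget_order_close_list by simp
  qed
qed

lemma pointed_filter_up:
  assumes "p \<in> pointed_filter n lam m" "q \<in> pointed_partitions n" "pointed_le p q"
  shows "q \<in> pointed_filter n lam m"
  using assms pointed_le_trans unfolding pointed_filter_def by blast

lemma pointed_filter_subset: "pointed_filter n lam m \<subseteq> pointed_partitions n"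
  unfolding pointed_filter_def by blast

text \<open>Among the pointed partitions for which a face is saturated, the one underlying the face
  is the greatest; since the filter is closed upwards, any witness in the filter forces that one to
  be in it. Any subface has the same witness.\<close>

lemma Lambda_complex_iff:
  "\<sigma> \<in> Lambda_complex n lam m \<longleftrightarrow>
    \<sigma> \<in> Delta_complex n \<and> (\<exists>p\<in>pointed_filter n lam m. saturated_face p \<sigma>)"
proof
  assume "\<sigma> \<in> Lambda_complex n lam m"
  then obtain Bs where Bs: "block_list n Bs" "\<sigma> = osp_simplex (close_list n Bs)"
    "forget_order (close_list n Bs) \<in> pointed_filter n lam m"
    unfolding Lambda_complex_def ordered_set_partitions_eq by blast
  moreover have "saturated_face (forget_order (close_list n Bs)) \<sigma>"
    using pointed_le_forget_order_iff[OF forget_order_in_pointed_partitions[OF Bs(1)] Bs(1)]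
      pointed_le_refl Bs(2) by blast
  ultimately show "\<sigma> \<in> Delta_complex n \<and> (\<exists>p\<in>pointed_filter n lam m. saturated_face p \<sigma>)"
    unfolding Delta_complex_def ordered_set_partitions_eq by blast
next
  assume "\<sigma> \<in> Delta_complex n \<and> (\<exists>p\<in>pointed_filter n lam m. saturated_face p \<sigma>)"
  then obtain p Bs where p: "p \<in> pointed_filter n lam m" "saturated_face p \<sigma>"
    and Bs: "block_list n Bs" "\<sigma> = osp_simplex (close_list n Bs)"
    unfolding Delta_complex_def ordered_set_partitions_eq by blast
  then have "pointed_le p (forget_order (close_list n Bs))"
    using pointed_le_forget_order_iff pointed_filter_subset by blast
  then have "forget_order (close_list n Bs) \<in> pointed_filter n lam m"
    using pointed_filter_up p(1) forget_order_in_pointed_partitions[OF Bs(1)] by blast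
  then show "\<sigma> \<in> Lambda_complex n lam m"
    using Bs unfolding Lambda_complex_def ordered_set_partitions_eq by blast
qed

text \<open>Blocks are split off one part at a time. Parts are positive, so the new block is
  nonempty and differs from the blocks of its complement; otherwise \<open>mset_set\<close> would
  miss a repeated part.\<close>

lemma exists_partition_of_type:
  assumes "finite S" "card S = sum_mset lam" "0 \<notin># lam"
  shows "\<exists>P. partition_on S P \<and> image_mset card (mset_set P) = lam"
  using assms
proof (induction lam arbitrary: S)
  case empty
  then show ?case by (intro exI[of _ "{}"]) (auto simp: partition_on_empty)
next
  case (add x lam)
  from add.prems(2) have "x \<le> card S" by simp
  then obtain T where T: "T \<subseteq> S" "card T = x" "finite T" by (rule obtain_subset_with_card_n)
  have "card (S - T) = sum_mset lam" using T add.prems by (simp add: card_Diff_subset)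
  with add.IH[of "S - T"] add.prems obtain P where
    P: "partition_on (S - T) P" "image_mset card (mset_set P) = lam" by auto
  have T0: "T \<noteq> {}" using T add.prems(3) by auto
  have "T \<notin> P" using P(1) T0 unfolding partition_on_def by blast
  moreover have "finite P" using finite_elements[OF _ P(1)] add.prems(1) by simp
  moreover have "partition_on S (insert T P)"
  proof -
    have "disjnt T (\<Union>P)" using P(1) unfolding partition_on_def disjnt_def by blast
    then show ?thesis using P(1) T(1) T0 by (simp add: partition_on_insert)
  qed
  ultimately show ?case using P(2) T(2) by (intro exI[of _ "insert T P"]) simp
qed

text \<open>This puts the empty face into \<open>Lambda_complex n lam m\<close>, which would
  otherwise have no faces at all.\<close>

lemma pointed_filter_nonempty:
  assumes "pointed_knapsack_partition lam m n"
  shows "pointed_filter n lam m \<noteq> {}"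
proof -
  from assms have *: "0 \<notin># lam" "sum_mset lam + m = n"
    unfolding pointed_knapsack_partition_def knapsack_partition_def by auto
  have "m \<le> card {1..n}" using * by simp
  then obtain Z where Z: "Z \<subseteq> {1..n}" "card Z = m" "finite Z" by (rule obtain_subset_with_card_n)
  have "card ({1..n} - Z) = sum_mset lam" using Z * by (simp add: card_Diff_subset)
  with exists_partition_of_type[of "{1..n} - Z" lam] *(1) obtain P where
    "partition_on ({1..n} - Z) P" "image_mset card (mset_set P) = lam" by auto
  then have "(P, Z) \<in> pointed_partitions n" "pointed_type (P, Z) = (lam, m)"
    using Z unfolding pointed_partitions_def by auto
  then have "(P, Z) \<in> pointed_filter n lam m"
    unfolding pointed_filter_def using pointed_le_refl by blast
  then show ?thesis by blast
qed

section \<open>Relabeling\<close>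

lemma relabel_pointed_inverse:
  "s permutes S \<Longrightarrow> relabel_pointed (inv s) (relabel_pointed s p) = p"
  by (cases p) (simp add: image_image permutes_inverses)

lemma relabel_osp_inverse: "s permutes S \<Longrightarrow> relabel_osp (inv s) (relabel_osp s V) = V"
  unfolding relabel_osp_def by (simp add: o_def image_image permutes_inverses)

lemma relabel_pointed_le: "pointed_le p q \<Longrightarrow> pointed_le (relabel_pointed s p) (relabel_pointed s q)"
proof (cases p; cases q)
  fix P Z P' Z'
  assume pq: "p = (P, Z)" "q = (P', Z')" and le: "pointed_le p q"
  have "\<exists>C\<in>insert (s ` Z') (image s ` P'). s ` B \<subseteq> C" if "B \<in> P" for B
  proof -
    from le that obtain C where "C \<in> insert Z' P'" "B \<subseteq> C" unfolding pq pointed_le.simps by blast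
    then show ?thesis by (intro bexI[of _ "s ` C"]) auto
  qed
  then show "pointed_le (relabel_pointed s p) (relabel_pointed s q)" using le unfolding pq by auto
qed

lemma relabel_pointed_partitions:
  assumes s: "s permutes {1..n}" and p: "p \<in> pointed_partitions n"
  shows "relabel_pointed s p \<in> pointed_partitions n" "pointed_type (relabel_pointed s p) = pointed_type p"
proof -
  obtain P Z where PZ: "p = (P, Z)" by (cases p)
  have Z: "Z \<subseteq> {1..n}" and P: "partition_on ({1..n} - Z) P" using p unfolding PZ pointed_partitions_def by auto
  have inj: "inj s" using s by (rule permutes_inj)
  have "s ` ({1..n} - Z) = {1..n} - s ` Z"
    using image_set_diff[OF inj, of "{1..n}" Z] permutes_image[OF s] by simp
  moreover have "partition_on (s ` ({1..n} - Z)) (image s ` P)"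
  proof (rule partition_onI)
    show "\<Union>(image s ` P) = s ` ({1..n} - Z)" using P unfolding partition_on_def by blast
    show "{} \<notin> image s ` P" using P unfolding partition_on_def by blast
    fix q q' assume "q \<in> image s ` P" "q' \<in> image s ` P" "q \<noteq> q'"
    then obtain B C where BC: "B \<in> P" "C \<in> P" "q = s ` B" "q' = s ` C" "B \<noteq> C" by blast
    then have "B \<inter> C = {}" using P unfolding partition_on_def disjoint_def by blast
    then show "disjnt q q'" unfolding BC disjnt_def using image_Int[OF inj, of B C] by simp
  qed
  moreover have "s ` Z \<subseteq> {1..n}" using Z permutes_image[OF s] by blast
  ultimately show "relabel_pointed s p \<in> pointed_partitions n"
    unfolding PZ pointed_partitions_def by simp
  have "inj_on (image s) P" using inj by (simp add: inj_on_def inj_image_eq_iff)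
  then have "image_mset card (mset_set (image s ` P)) = image_mset card (mset_set P)"
    using inj by (simp add: image_mset_mset_set[symmetric] multiset.map_comp o_def card_image inj_on_subset)
  then show "pointed_type (relabel_pointed s p) = pointed_type p"
    unfolding PZ using inj by (simp add: card_image inj_on_subset)
qed

lemma relabel_pointed_filter:
  assumes s: "s permutes {1..n}" and p: "p \<in> pointed_filter n lam m"
  shows "relabel_pointed s p \<in> pointed_filter n lam m"
proof -
  from p obtain q where "p \<in> pointed_partitions n" "q \<in> pointed_partitions n" "pointed_type q = (lam, m)"
    "pointed_le q p" unfolding pointed_filter_def by blast
  moreover from this have "pointed_type (relabel_pointed s q) = (lam, m)"
    using relabel_pointed_partitions(2)[OF s] by simp
  ultimately show ?thesis
    using relabel_pointed_partitions(1)[OF s] relabel_pointed_le[of q p s] unfolding pointed_filter_def by blast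
qed

lemma relabel_pointed_top: "s permutes {1..n} \<Longrightarrow> relabel_pointed s (pointed_top n) = pointed_top n"
  unfolding pointed_top_def by (simp add: permutes_image)

lemma relabel_saturated:
  assumes "inj s" "saturated p A"
  shows "saturated (relabel_pointed s p) (s ` A)"
proof (cases p)
  case (Pair P Z)
  then show ?thesis using assms(2)
    by (auto simp: image_Int[OF assms(1), symmetric] inj_image_subset_iff[OF assms(1)])
qed

lemma relabel_saturated_face:
  assumes "inj s" "saturated_face p \<sigma>"
  shows "saturated_face (relabel_pointed s p) (relabel_osp s ` \<sigma>)"
  using assms relabel_saturated unfolding saturated_face_def relabel_osp_def by (auto simp: hd_map)

lemma relabel_cut_vertex:
  assumes "s permutes {1..n}"
  shows "relabel_osp s (cut_vertex n A) = cut_vertex n (s ` A)"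
  using image_set_diff[OF permutes_inj[OF assms], of "{1..n}" A] permutes_image[OF assms]
  unfolding relabel_osp_def cut_vertex_def by simp

lemma relabel_Lambda_complex:
  assumes s: "s permutes {1..n}" and \<sigma>: "\<sigma> \<in> Lambda_complex n lam m"
  shows "relabel_osp s ` \<sigma> \<in> Lambda_complex n lam m"
proof -
  from \<sigma> obtain \<A> p where \<A>: "set_chain n \<A>" "\<sigma> = cut_vertex n ` \<A>"
    and p: "p \<in> pointed_filter n lam m" "saturated_face p \<sigma>"
    unfolding Lambda_complex_iff Delta_complex_iff by blast
  have "s ` A \<subseteq> {1..n}" if "A \<in> \<A>" for A
    using \<A>(1) that image_mono[of A "{1..n}" s] permutes_image[OF s] unfolding set_chain_def by auto
  moreover have "s ` A \<subseteq> s ` B \<or> s ` B \<subseteq> s ` A" if "A \<in> \<A>" "B \<in> \<A>" for A B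
    using \<A>(1) that image_mono[of A B s] image_mono[of B A s] unfolding set_chain_def by meson
  ultimately have "set_chain n (image s ` \<A>)" using \<A>(1) unfolding set_chain_def by simp
  moreover have "relabel_osp s ` \<sigma> = cut_vertex n ` image s ` \<A>"
    unfolding \<A>(2) image_image relabel_cut_vertex[OF s] ..
  ultimately show ?thesis
    using relabel_saturated_face[OF permutes_inj[OF s] p(2)] relabel_pointed_filter[OF s p(1)]
    unfolding Lambda_complex_iff Delta_complex_iff by blast
qed

text \<open>The two apexes are the pointed partition underlying a nonempty face, and the vertex cut
  off by the union of the non-pointed blocks of a poset element.\<close>

lemma poset_cylinder_Lambda_complex:
  assumes "pointed_filter n lam m \<noteq> {}"
  shows "poset_cylinder pointed_le (pointed_filter n lam m - {pointed_top n}) saturated_face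
    (Lambda_complex n lam m)"
proof
  have "pointed_partitions n \<subseteq> Pow (Pow {1..n}) \<times> Pow {1..n}"
    unfolding pointed_partitions_def partition_on_def by auto
  then have "finite (pointed_partitions n)" by (rule finite_subset) simp
  then have "finite (pointed_filter n lam m)" using pointed_filter_subset by (rule finite_subset[rotated])
  then show "finite (pointed_filter n lam m - {pointed_top n})" by simp
  have "\<Union>(Lambda_complex n lam m) \<subseteq> cut_vertex n ` Pow {1..n}"
  proof
    fix V assume "V \<in> \<Union>(Lambda_complex n lam m)"
    then obtain \<A> where "set_chain n \<A>" "V \<in> cut_vertex n ` \<A>"
      unfolding Union_iff Bex_def Lambda_complex_iff Delta_complex_iff by blast
    then show "V \<in> cut_vertex n ` Pow {1..n}" unfolding set_chain_def by blast
  qed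
  then show "finite (\<Union>(Lambda_complex n lam m))" by (rule finite_subset) simp
  show "\<tau> \<in> Lambda_complex n lam m" if "\<sigma> \<in> Lambda_complex n lam m" "\<tau> \<subseteq> \<sigma>" for \<sigma> \<tau>
  proof -
    from that(1) obtain \<A> p where \<A>: "set_chain n \<A>" "\<sigma> = cut_vertex n ` \<A>"
      and p: "p \<in> pointed_filter n lam m" "saturated_face p \<sigma>"
      unfolding Lambda_complex_iff Delta_complex_iff by blast
    from that(2) \<A>(2) obtain \<B> where "\<B> \<subseteq> \<A>" "\<tau> = cut_vertex n ` \<B>" by (auto simp: subset_image_iff)
    moreover have "saturated_face p \<tau>" using p(2) that(2) unfolding saturated_face_def by blast
    ultimately show ?thesis
      using set_chain_subset[OF \<A>(1)] p(1) unfolding Lambda_complex_iff Delta_complex_iff by blast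
  qed
  show "{} \<in> Lambda_complex n lam m"
    using assms unfolding Lambda_complex_iff Delta_complex_iff set_chain_def saturated_face_def by auto
  show "pointed_le p p" for p by (rule pointed_le_refl)
  show "pointed_le p q \<Longrightarrow> pointed_le q r \<Longrightarrow> pointed_le p r" for p q r by (rule pointed_le_trans)
  show "saturated_face p {}" for p unfolding saturated_face_def by simp
  show "saturated_face p \<sigma> \<Longrightarrow> \<tau> \<subseteq> \<sigma> \<Longrightarrow> saturated_face p \<tau>" for p \<sigma> \<tau> unfolding saturated_face_def by blast
  show "pointed_le p q \<Longrightarrow> saturated_face q \<sigma> \<Longrightarrow> saturated_face p \<sigma>" for p q \<sigma>
    using saturated_le unfolding saturated_face_def by blast
next
  fix \<sigma> assume \<sigma>: "\<sigma> \<in> Lambda_complex n lam m" "\<sigma> \<noteq> {}"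
  then obtain Bs where Bs: "block_list n Bs" "\<sigma> = osp_simplex (close_list n Bs)"
    "forget_order (close_list n Bs) \<in> pointed_filter n lam m"
    unfolding Lambda_complex_def ordered_set_partitions_eq by blast
  \<comment> \<open>A nonempty face has a non-pointed block, so the partition underlying it survives
    the removal of the top.\<close>
  have "Bs \<noteq> []" using \<sigma>(2) Bs(1,2) by (auto simp: osp_simplex_close_list)
  then have "forget_order (close_list n Bs) \<noteq> pointed_top n"
    unfolding forget_order_close_list pointed_top_def by simp
  moreover have "saturated_face (forget_order (close_list n Bs)) \<sigma>"
    using pointed_le_forget_order_iff[OF forget_order_in_pointed_partitions[OF Bs(1)] Bs(1)]
      pointed_le_refl Bs(2) by blast
  moreover have "pointed_le p (forget_order (close_list n Bs))"
    if "p \<in> pointed_filter n lam m" "saturated_face p \<sigma>" for p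
    using pointed_le_forget_order_iff[OF _ Bs(1)] that pointed_filter_subset Bs(2) by blast
  ultimately show "\<exists>q\<in>pointed_filter n lam m - {pointed_top n}. saturated_face q \<sigma> \<and>
      (\<forall>p\<in>pointed_filter n lam m - {pointed_top n}. saturated_face p \<sigma> \<longrightarrow> pointed_le p q)"
    using Bs(3) by blast
next
  fix p assume p: "p \<in> pointed_filter n lam m - {pointed_top n}"
  obtain P Z where PZ: "p = (P, Z)" by (cases p)
  have "p \<in> pointed_partitions n" using p pointed_filter_subset by blast
  then have Z: "Z \<subseteq> {1..n}" and P: "partition_on ({1..n} - Z) P"
    unfolding PZ pointed_partitions_def by auto
  define A where "A = {1..n} - Z"
  have "A \<noteq> {}"
  proof
    assume "A = {}"
    then have "Z = {1..n}" "P = {}" using Z P unfolding A_def by (auto simp: partition_on_empty)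
    with p show False unfolding PZ pointed_top_def by simp
  qed
  have satA: "saturated p A" using P unfolding PZ A_def partition_on_def by auto
  have "insert (cut_vertex n A) \<sigma> \<in> Lambda_complex n lam m \<and> saturated_face p (insert (cut_vertex n A) \<sigma>)"
    if \<sigma>: "\<sigma> \<in> Lambda_complex n lam m" "saturated_face p \<sigma>" for \<sigma>
  proof -
    from \<sigma>(1) obtain \<A> where \<A>: "set_chain n \<A>" "\<sigma> = cut_vertex n ` \<A>"
      unfolding Lambda_complex_iff Delta_complex_iff by blast
    \<comment> \<open>Saturated sets avoid the pointed block, so \<open>A\<close> is the largest of
      them and can join any chain of saturated sets.\<close>
    have "B \<subseteq> A" if "B \<in> \<A>" for B
    proof -
      have "saturated p B" using \<sigma>(2) that unfolding \<A>(2) saturated_face_cut_vertex by blast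
      moreover have "B \<subseteq> {1..n}" using \<A>(1) that unfolding set_chain_def by blast
      ultimately show ?thesis unfolding PZ A_def by auto
    qed
    then have "set_chain n (insert A \<A>)"
      using \<A>(1) \<open>A \<noteq> {}\<close> unfolding set_chain_def A_def by auto
    moreover have "insert (cut_vertex n A) \<sigma> = cut_vertex n ` insert A \<A>" unfolding \<A>(2) by simp
    moreover have "saturated_face p (insert (cut_vertex n A) \<sigma>)"
      using satA \<sigma>(2) unfolding saturated_face_def cut_vertex_def by simp
    ultimately show ?thesis using p unfolding Lambda_complex_iff Delta_complex_iff by blast
  qed
  then show "\<exists>a. \<forall>\<sigma>\<in>Lambda_complex n lam m. saturated_face p \<sigma> \<longrightarrow>
      insert a \<sigma> \<in> Lambda_complex n lam m \<and> saturated_face p (insert a \<sigma>)" by blast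
qed

theorem theorem10p1:
  fixes lam :: "nat multiset" and m n k :: nat
  assumes "pointed_knapsack_partition lam m n"
    and "m > 0"
    and "size lam = k"
  shows "gmodule_isomorphic {s. s permutes {1..n}}
    (reduced_homology relabel_pointed
       (order_complex pointed_le (pointed_filter n lam m - {pointed_top n})) (int k - 1)
     :: ('f::field, nat \<Rightarrow> nat, (pointed_part list \<Rightarrow> 'f) set) gmodule)
    (reduced_homology relabel_osp (Lambda_complex n lam m) (int k - 1))"
proof (rule poset_cylinder.homology_iso[OF poset_cylinder_Lambda_complex])
  show "pointed_filter n lam m \<noteq> {}" using assms(1) by (rule pointed_filter_nonempty)
  fix s assume "s \<in> {s. s permutes {1..n}}"
  then have s: "s permutes {1..n}" by simp
  then show "inv s \<in> {s. s permutes {1..n}}" "inv (inv s) = s"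
    by (simp_all add: permutes_inv permutes_inv_inv)
  show "relabel_pointed (inv s) (relabel_pointed s p) = p" for p
    using s by (rule relabel_pointed_inverse)
  show "relabel_osp (inv s) (relabel_osp s V) = V" for V
    using s by (rule relabel_osp_inverse)
  show "relabel_pointed s p \<in> pointed_filter n lam m - {pointed_top n}"
    if p: "p \<in> pointed_filter n lam m - {pointed_top n}" for p
  proof -
    \<comment> \<open>The top is fixed by \<open>inv s\<close>, so only the top itself can be
      relabeled to the top.\<close>
    have "relabel_pointed s p \<noteq> pointed_top n"
      using p relabel_pointed_inverse[OF s, of p] relabel_pointed_top[OF permutes_inv[OF s]] by auto
    then show ?thesis using relabel_pointed_filter[OF s] p by blast
  qed
  show "pointed_le p q \<Longrightarrow> pointed_le (relabel_pointed s p) (relabel_pointed s q)" for p q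
    by (rule relabel_pointed_le)
  show "F \<in> Lambda_complex n lam m \<Longrightarrow> relabel_osp s ` F \<in> Lambda_complex n lam m" for F
    by (rule relabel_Lambda_complex[OF s])
  show "saturated_face p F \<Longrightarrow> saturated_face (relabel_pointed s p) (relabel_osp s ` F)" for p F
    by (rule relabel_saturated_face[OF permutes_inj[OF s]])
qed

end
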